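(* Let $n,m\ge 1$ be integers, let $T=\{t_1,\dots,t_m\}$, let $D_n\subset\{a_1,b_1,\dots,a_n,b_n\}^*$ be the Dyck language with $n$ kinds of parentheses, let $\phi:\{a_1,b_1,\dots,a_n,b_n\}^*\to T^*$ be a monoid homomorphism, and let $L=\phi(D_n)\subset T^*$. Let $d$ be the maximum of the lengths of the words $\phi(a_1),\phi(b_1),\dots,\phi(a_n),\phi(b_n)$, and assume $d\ge 1$. Let $\mathbb{K}$ be a field and let $X$ be the set of pairwise distinct letters $a_i,\ b_i,\ a_i^j,\ b_i^j,\ x,\ e,\ y,\ t_k$ ($1\le i,j\le n$, $1\le k\le m$), where $a_i^j,b_i^j$ are single letters and upper indices are not exponents. Let $R\subset\mathbb{K}\langle X\rangle$ consist of the following elements, for all $i,j,l\in\{1,\dots,n\}$: (i) $a_i^i x-xa_i^i$, $\; b_1^1x-xe$; (ii) $a_i^ja_l-a_ia_l^j$, $\; a_i^jb_l-a_ib_l^j$, $\; b_i^ja_l-b_ia_l^j$, $\; b_i^jb_l-b_ib_l^j$, $\; a_i^je-a_ib_j$, $\; b_i^je-b_ib_j$; (iii) $a_iy-y\phi(a_i)$, $\; b_iy-y\phi(b_i)$, $\; a_i^jy$, $\; b_i^jy$; (iv) $xye$. Equip $X^*$ with the degree-lexicographic ordering based on the degree function $|a_i|=|b_i|=|a_i^j|=|b_i^j|=|x|=|y|=|e|=d$, $|t_k|=1$, and on a total order of the letters in which every $a_i^j$ is greater than every $b_i^j$, every $b_i^j$ is greater than every $a_i$, every $a_i$ is greater than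 every $b_i$, every $b_i$ is greater than $e$, $e>x>y$, and $y$ is greater than every $t_k$. Then the minimal Gröbner basis of the two-sided ideal of $\mathbb{K}\langle X\rangle$ generated by $R$ is the disjoint union of the set of elements (i)--(iii) with the set of monomials $$xP_nyLe=\{x\,p\,y\,v\,e\mid p\in P_n,\ v\in L\},$$ where $P_n=(D_ne)^*\subset\{a_1,b_1,\dots,a_n,b_n,e\}^*$ is the language consisting of the empty word and the words of the form $e^{i_0}w_1e^{i_1}\cdots w_se^{i_s}$ with $s,i_0\ge 0$, $i_1,\dots,i_s>0$ and $w_1,\dots,w_s\in D_n$.
   Context: $X^*$ is the free monoid on $X$ (words, including the empty word $1$), and $\mathbb{K}\langle X\rangle$ is the free unital associative algebra. The Dyck language $D_n$ is the set of all words with balanced parentheses of $n$ possible kinds, where $a_i$ is the opening and $b_i$ the closing parenthesis of the $i$-th kind; it contains the empty word. Equivalently, it is the smallest set of words that contains the empty word, is closed under concatenation, and contains $a_iwb_i$ whenever it contains $w$. Degree-lexicographic ordering: the degree of a word is the sum of the degrees of its letters; words are compared first by degree and, in case of equal degree, lexicographically from left to right with respect to the order of the letters. For $0\ne f\in\mathbb{K}\langle X\rangle$, $\mathrm{lm}(f)$ denotes the greatest word occurring in $f$ with nonzero coefficient. A (possibly infinite) subset $U$ of a two-sided ideal $I$ is a Gröbner basis of $I$ if the words $\mathrm{lm}(f)$, $0\neq f\in U$, generate the two-sided monomial ideal $\langle\mathrm{lm}(f)\mid 0\ne f\in I\rangle$. It is minimal if $\mathrm{lm}(U)$ is a minimal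 monomial generating set of this ideal, i.e. no word $\mathrm{lm}(f)$, $f\in U$, contains $\mathrm{lm}(g)$ as a subword for a different $g\in U$. *)

theory Defs
  imports
    Complex_Main
    "HOL-Library.Poly_Mapping"
    "HOL-Library.Sublist"
    "HOL-Algebra.Ideal"
begin

text \<open>
  Words are lists. Concatenation is registered as a (noncommutative, additively written) monoid,
  so that the convolution product on finitely supported functions
  \<open>'x list \<Rightarrow>\<^sub>0 'k\<close> is the multiplication of the free associative algebra.
\<close>

instantiation list :: (type) monoid_add
begin

definition zero_list :: "'a list" where "zero_list = []"

definition plus_list :: "'a list \<Rightarrow> 'a list \<Rightarrow> 'a list" where "plus_list u v = u @ v"

instance by standard (simp_all add: zero_list_def plus_list_def)

end

definition word_poly :: "'x list \<Rightarrow> ('x list \<Rightarrow>\<^sub>0 'k::field)" where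
  "word_poly w = Poly_Mapping.single w 1"

definition free_algebra :: "'x set \<Rightarrow> ('x list \<Rightarrow>\<^sub>0 'k::field) ring" where
  "free_algebra X =
    \<lparr>carrier = {f. Poly_Mapping.keys f \<subseteq> lists X}, mult = (*), one = 1, zero = 0, add = (+)\<rparr>"

lemma word_poly_mult: "word_poly u * word_poly v = word_poly (u @ v)"
  by (simp add: word_poly_def mult_single plus_list_def)

lemma word_poly_Nil: "word_poly [] = 1"
  by (metis word_poly_def single_one zero_list_def)

lemma ring_free_algebra: "ring (free_algebra X :: ('x list \<Rightarrow>\<^sub>0 'k::field) ring)"
proof -
  let ?R = "\<lparr>carrier = {f :: 'x list \<Rightarrow>\<^sub>0 'k. Poly_Mapping.keys f \<subseteq> lists X},
    mult = (*), one = 1, zero = 0, add = (+)\<rparr>"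
  let ?C = "{f :: 'x list \<Rightarrow>\<^sub>0 'k. Poly_Mapping.keys f \<subseteq> lists X}"
  have add: "f + g \<in> ?C" if "f \<in> ?C" "g \<in> ?C" for f g
    using that keys_add[of f g] by blast
  have mult: "f * g \<in> ?C" if "f \<in> ?C" "g \<in> ?C" for f g
  proof -
    have "{a + b |a b. a \<in> Poly_Mapping.keys f \<and> b \<in> Poly_Mapping.keys g} \<subseteq> lists X"
      using that by (auto simp: plus_list_def dest!: subsetD)
    then show ?thesis using keys_mult[of f g] by blast
  qed
  have neg: "\<exists>g\<in>?C. g + f = 0" if "f \<in> ?C" for f
    using that by (intro bexI[of _ "- f"]) simp_all
  have one: "1 \<in> ?C"
    by (simp flip: single_one add: zero_list_def)
  show ?thesis
  proof (rule ringI)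
    show "abelian_group (free_algebra X :: ('x list \<Rightarrow>\<^sub>0 'k) ring)"
      unfolding free_algebra_def
    proof (rule abelian_groupI)
      show "\<exists>y\<in>carrier ?R. y \<oplus>\<^bsub>?R\<^esub> f = \<zero>\<^bsub>?R\<^esub>" if "f \<in> carrier ?R" for f
        using neg that by simp
    qed (simp_all del: mem_Collect_eq add: add ac_simps, simp)
    show "Group.monoid (free_algebra X :: ('x list \<Rightarrow>\<^sub>0 'k) ring)"
      unfolding free_algebra_def
      by (rule monoidI; simp del: mem_Collect_eq add: mult one mult.assoc)
  qed (simp_all add: free_algebra_def distrib_left distrib_right)
qed

text \<open>\<open>wless\<close> is a strict word order: \<open>(u, v) \<in> wless\<close> means that \<open>u\<close> is smaller
  than \<open>v\<close>. The value \<open>lm wless 0\<close> is meaningless; hence \<open>f \<noteq> 0\<close> in \<open>lm_ideal\<close> and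
  \<open>0 \<notin> U\<close> in the definition of a minimal basis.\<close>

definition lm :: "'x list rel \<Rightarrow> ('x list \<Rightarrow>\<^sub>0 'k::field) \<Rightarrow> 'x list" where
  "lm wless f = (THE w. w \<in> Poly_Mapping.keys f \<and> (\<forall>v\<in>Poly_Mapping.keys f. v \<noteq> w \<longrightarrow> (v, w) \<in> wless))"

definition lm_ideal ::
  "'x set \<Rightarrow> 'x list rel \<Rightarrow> ('x list \<Rightarrow>\<^sub>0 'k::field) set \<Rightarrow> ('x list \<Rightarrow>\<^sub>0 'k) set" where
  "lm_ideal X wless S = Idl\<^bsub>free_algebra X\<^esub> {word_poly (lm wless f) |f. f \<in> S \<and> f \<noteq> 0}"

definition is_groebner_basis ::
  "'x set \<Rightarrow> 'x list rel \<Rightarrow> ('x list \<Rightarrow>\<^sub>0 'k::field) set \<Rightarrow> ('x list \<Rightarrow>\<^sub>0 'k) set \<Rightarrow> bool" where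
  "is_groebner_basis X wless I U \<longleftrightarrow> U \<subseteq> I \<and> lm_ideal X wless U = lm_ideal X wless I"

definition is_minimal_groebner_basis ::
  "'x set \<Rightarrow> 'x list rel \<Rightarrow> ('x list \<Rightarrow>\<^sub>0 'k::field) set \<Rightarrow> ('x list \<Rightarrow>\<^sub>0 'k) set \<Rightarrow> bool" where
  "is_minimal_groebner_basis X wless I U \<longleftrightarrow>
    is_groebner_basis X wless I U \<and> 0 \<notin> U \<and>
    (\<forall>f\<in>U. \<forall>g\<in>U. f \<noteq> g \<longrightarrow> \<not> sublist (lm wless g) (lm wless f))"

text \<open>
  \<open>r\<close> is the reflexive order of the letters. Since letters have positive degree, of two distinct
  words of equal degree neither is a prefix of the other, so the prefix clause in
  \<^const>\<open>lexord\<close> plays no role.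
\<close>

definition deglex :: "'x set \<Rightarrow> ('x \<Rightarrow> nat) \<Rightarrow> 'x rel \<Rightarrow> 'x list rel" where
  "deglex X wt r = {(u, v). u \<in> lists X \<and> v \<in> lists X \<and>
    (sum_list (map wt u) < sum_list (map wt v) \<or>
     sum_list (map wt u) = sum_list (map wt v) \<and> (u, v) \<in> lexord (r - Id))}"

text \<open>\<open>Laj i j\<close> and \<open>Lbj i j\<close> stand for the single letters $a_i^j$ and $b_i^j$.\<close>

datatype letter =
  La nat | Lb nat | Laj nat nat | Lbj nat nat | Lx | Le | Ly | Lt nat

definition parens :: "nat \<Rightarrow> letter set" where
  "parens n = La ` {1..n} \<union> Lb ` {1..n}"

definition terminals :: "nat \<Rightarrow> letter set" where
  "terminals m = Lt ` {1..m}"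

definition letters :: "nat \<Rightarrow> nat \<Rightarrow> letter set" where
  "letters n m = parens n \<union> {Laj i j |i j. i \<in> {1..n} \<and> j \<in> {1..n}} \<union>
    {Lbj i j |i j. i \<in> {1..n} \<and> j \<in> {1..n}} \<union> {Lx, Le, Ly} \<union> terminals m"

fun letter_degree :: "nat \<Rightarrow> letter \<Rightarrow> nat" where
  "letter_degree d (Lt k) = 1"
| "letter_degree d _ = d"

definition admissible_letter_order :: "nat \<Rightarrow> nat \<Rightarrow> letter rel \<Rightarrow> bool" where
  "admissible_letter_order n m r \<longleftrightarrow>
    linear_order_on (letters n m) r \<and>
    (\<forall>i\<in>{1..n}. \<forall>j\<in>{1..n}. \<forall>k\<in>{1..n}. \<forall>l\<in>{1..n}. (Lbj k l, Laj i j) \<in> r) \<and>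
    (\<forall>i\<in>{1..n}. \<forall>j\<in>{1..n}. \<forall>k\<in>{1..n}. (La k, Lbj i j) \<in> r) \<and>
    (\<forall>i\<in>{1..n}. \<forall>k\<in>{1..n}. (Lb k, La i) \<in> r) \<and>
    (\<forall>i\<in>{1..n}. (Le, Lb i) \<in> r) \<and>
    (Lx, Le) \<in> r \<and> (Ly, Lx) \<in> r \<and>
    (\<forall>k\<in>{1..m}. (Lt k, Ly) \<in> r)"

inductive_set dyck :: "nat \<Rightarrow> letter list set" for n :: nat where
  Nil: "[] \<in> dyck n"
| append: "u \<in> dyck n \<Longrightarrow> v \<in> dyck n \<Longrightarrow> u @ v \<in> dyck n"
| nest: "w \<in> dyck n \<Longrightarrow> i \<in> {1..n} \<Longrightarrow> La i # w @ [Lb i] \<in> dyck n"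

definition word_hom :: "'x set \<Rightarrow> 'x set \<Rightarrow> ('x list \<Rightarrow> 'x list) \<Rightarrow> bool" where
  "word_hom A B \<phi> \<longleftrightarrow> \<phi> [] = [] \<and> (\<forall>u\<in>lists A. \<phi> u \<in> lists B) \<and>
    (\<forall>u\<in>lists A. \<forall>v\<in>lists A. \<phi> (u @ v) = \<phi> u @ \<phi> v)"

definition kleene_star :: "'x list set \<Rightarrow> 'x list set" where
  "kleene_star S = concat ` lists S"

definition lang_P :: "nat \<Rightarrow> letter list set" where
  "lang_P n = kleene_star {w @ [Le] |w. w \<in> dyck n}"

lemma lang_P_altdef:
  "lang_P n = {replicate i0 Le @ concat (map (\<lambda>(w, i). w @ replicate i Le) ws) |i0 ws.
     \<forall>(w, i)\<in>set ws. w \<in> dyck n \<and> i > 0}" (is "_ = ?R")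
proof -
  let ?S = "{w @ [Le] |w. w \<in> dyck n}"
  have append: "u @ v \<in> kleene_star ?S" if "u \<in> kleene_star ?S" "v \<in> kleene_star ?S" for u v
  proof -
    from that obtain us vs where "us \<in> lists ?S" "vs \<in> lists ?S" "u = concat us" "v = concat vs"
      unfolding kleene_star_def by blast
    then have "us @ vs \<in> lists ?S" "u @ v = concat (us @ vs)" by auto
    then show ?thesis unfolding kleene_star_def by blast
  qed
  have Nil: "[] \<in> kleene_star ?S"
    unfolding kleene_star_def by (rule image_eqI[of _ _ "[]"]) auto
  have single: "w @ [Le] \<in> kleene_star ?S" if "w \<in> dyck n" for w
    unfolding kleene_star_def using that by (intro image_eqI[of _ _ "[w @ [Le]]"]) auto
  have power: "replicate i Le \<in> kleene_star ?S" for i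
  proof (induction i)
    case (Suc i)
    then show ?case using append[OF single[OF dyck.Nil] Suc] by simp
  qed (simp add: Nil)
  have block: "w @ replicate i Le \<in> kleene_star ?S" if "w \<in> dyck n" "i > 0" for w i
    using append[OF single[OF that(1)] power[of "i - 1"]] that(2) by (cases i) auto
  have "concat (map (\<lambda>(w, i). w @ replicate i Le) ws) \<in> kleene_star ?S"
    if "\<forall>(w, i)\<in>set ws. w \<in> dyck n \<and> i > 0" for ws
    using that
  proof (induction ws)
    case (Cons x ws)
    obtain w i where x: "x = (w, i)" by (cases x)
    then have "w @ replicate i Le \<in> kleene_star ?S" using Cons.prems block by simp
    from append[OF this Cons.IH] Cons.prems show ?case using x by simp
  qed (simp add: Nil)
  then have "?R \<subseteq> lang_P n"
    unfolding lang_P_def using append power by blast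
  moreover have "lang_P n \<subseteq> ?R"
  proof
    fix p assume "p \<in> lang_P n"
    then obtain us where us: "us \<in> lists ?S" "p = concat us"
      unfolding lang_P_def kleene_star_def by blast
    have "\<exists>ws. concat us = concat (map (\<lambda>(w, i). w @ replicate i Le) ws) \<and>
        (\<forall>(w, i)\<in>set ws. w \<in> dyck n \<and> i > 0)"
      using us(1)
    proof (induction us)
      case Nil
      show ?case by (intro exI[of _ "[]"]) simp
    next
      case (Cons u us)
      then obtain w ws where "u = w @ [Le]" "w \<in> dyck n"
        "concat us = concat (map (\<lambda>(w, i). w @ replicate i Le) ws)"
        "\<forall>(w, i)\<in>set ws. w \<in> dyck n \<and> i > 0" by blast
      then show ?case
        by (intro exI[of _ "(w, 1) # ws"]) auto
    qed
    then obtain ws where "p = replicate 0 Le @ concat (map (\<lambda>(w, i). w @ replicate i Le) ws)"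
      "\<forall>(w, i)\<in>set ws. w \<in> dyck n \<and> i > 0" using us(2) by auto
    then show "p \<in> ?R" by blast
  qed
  ultimately show ?thesis by blast
qed

definition relations_i :: "nat \<Rightarrow> (letter list \<Rightarrow>\<^sub>0 'k::field) set" where
  "relations_i n =
    {word_poly [Laj i i, Lx] - word_poly [Lx, Laj i i] |i. i \<in> {1..n}} \<union>
    {word_poly [Lbj 1 1, Lx] - word_poly [Lx, Le]}"

definition relations_ii :: "nat \<Rightarrow> (letter list \<Rightarrow>\<^sub>0 'k::field) set" where
  "relations_ii n =
    (\<Union>i\<in>{1..n}. \<Union>j\<in>{1..n}. \<Union>l\<in>{1..n}.
      {word_poly [Laj i j, La l] - word_poly [La i, Laj l j],
       word_poly [Laj i j, Lb l] - word_poly [La i, Lbj l j],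
       word_poly [Lbj i j, La l] - word_poly [Lb i, Laj l j],
       word_poly [Lbj i j, Lb l] - word_poly [Lb i, Lbj l j],
       word_poly [Laj i j, Le] - word_poly [La i, Lb j],
       word_poly [Lbj i j, Le] - word_poly [Lb i, Lb j]})"

definition relations_iii ::
  "nat \<Rightarrow> (letter list \<Rightarrow> letter list) \<Rightarrow> (letter list \<Rightarrow>\<^sub>0 'k::field) set" where
  "relations_iii n \<phi> =
    (\<Union>i\<in>{1..n}. \<Union>j\<in>{1..n}.
      {word_poly [La i, Ly] - word_poly (Ly # \<phi> [La i]),
       word_poly [Lb i, Ly] - word_poly (Ly # \<phi> [Lb i]),
       word_poly [Laj i j, Ly],
       word_poly [Lbj i j, Ly]})"

definition relations_iv :: "(letter list \<Rightarrow>\<^sub>0 'k::field) set" where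
  "relations_iv = {word_poly [Lx, Ly, Le]}"

definition monomials_xPyLe ::
  "nat \<Rightarrow> letter list set \<Rightarrow> (letter list \<Rightarrow>\<^sub>0 'k::field) set" where
  "monomials_xPyLe n L = {word_poly ([Lx] @ p @ [Ly] @ v @ [Le]) |p v. p \<in> lang_P n \<and> v \<in> L}"

end

theory Submission
  imports Defs
begin

text \<open>
  Every relation equates two words or a word with zero, so normal forms are words or zero. They
  are constructed directly: each letter acts by left multiplication on words extended by a zero
  (van der Waerden's method), and the defining relations hold for these operators. Applying a
  word to the empty word fixes every word that avoids all leading words and never produces a
  larger word. If the leading word of a nonzero element of the ideal were fixed, its coefficient
  could not cancel, whereas the ideal acts by zero. Hence every leading word of the ideal contains
  one of the listed leading words.

  For the converse inclusion, \<open>x z = 0\<close> implies \<open>x e z = 0\<close> by \<open>b\<^sub>1\<^sup>1 x = x e\<close>, and \<open>x w e z = 0\<close>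
  implies \<open>x a\<^sub>i w b\<^sub>i z = 0\<close> by letting \<open>a\<^sub>i\<^sup>i\<close> travel from the left of \<open>x\<close> to the letter \<open>e\<close>. So
  Dyck words can be inserted behind \<open>x\<close>, and those adjacent to \<open>y\<close> are translated by \<open>\<phi>\<close>.
\<close>

section \<open>Ideals of the free algebra\<close>

lemma carrier_free_algebra_iff:
  "f \<in> carrier (free_algebra X) \<longleftrightarrow> Poly_Mapping.keys f \<subseteq> lists X"
  by (simp add: free_algebra_def)

lemma carrier_free_algebra_word_poly [simp]:
  "word_poly w \<in> carrier (free_algebra X) \<longleftrightarrow> w \<in> lists X"
  by (simp add: carrier_free_algebra_iff word_poly_def)

lemma uminus_one_carrier: "- 1 \<in> carrier (free_algebra X)"
  by (simp add: carrier_free_algebra_iff flip: word_poly_Nil)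
    (simp add: word_poly_def)

context
  fixes I :: "('x list \<Rightarrow>\<^sub>0 'k::field) set" and X :: "'x set"
  assumes ideal: "ideal I (free_algebra X)"
begin

interpretation ideal I "free_algebra X" by (fact ideal)

lemma ideal_free_algebra_add: "f \<in> I \<Longrightarrow> g \<in> I \<Longrightarrow> f + g \<in> I"
  using additive_subgroup.a_closed[OF is_additive_subgroup, of f g] by (simp add: free_algebra_def)

lemma ideal_free_algebra_mult_left: "f \<in> I \<Longrightarrow> h \<in> carrier (free_algebra X) \<Longrightarrow> h * f \<in> I"
  using I_l_closed[of f h] by (simp add: free_algebra_def)

lemma ideal_free_algebra_mult_right: "f \<in> I \<Longrightarrow> h \<in> carrier (free_algebra X) \<Longrightarrow> f * h \<in> I"
  using I_r_closed[of f h] by (simp add: free_algebra_def)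

lemma ideal_free_algebra_diff:
  assumes "f \<in> I" "g \<in> I"
  shows "f - g \<in> I"
proof -
  have "(- 1) * g \<in> I"
    using assms(2) uminus_one_carrier by (rule ideal_free_algebra_mult_left)
  from ideal_free_algebra_add[OF assms(1) this] show ?thesis by simp
qed

lemma ideal_free_algebra_sandwich:
  assumes "f \<in> I" "p \<in> lists X" "q \<in> lists X"
  shows "word_poly p * f * word_poly q \<in> I"
  using assms by (intro ideal_free_algebra_mult_left ideal_free_algebra_mult_right) simp_all

end

text \<open>Negatives arise by left multiplication with \<open>- 1\<close>, which lies in the
  carrier; so the listed closure properties already make \<open>K\<close> an additive
  subgroup.\<close>

lemma ideal_free_algebraI:
  fixes K :: "('x list \<Rightarrow>\<^sub>0 'k::field) set"
  assumes K: "K \<subseteq> carrier (free_algebra X)" "0 \<in> K"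
    and add: "\<And>f g. f \<in> K \<Longrightarrow> g \<in> K \<Longrightarrow> f + g \<in> K"
    and left: "\<And>f h. f \<in> K \<Longrightarrow> h \<in> carrier (free_algebra X) \<Longrightarrow> h * f \<in> K"
    and right: "\<And>f h. f \<in> K \<Longrightarrow> h \<in> carrier (free_algebra X) \<Longrightarrow> f * h \<in> K"
  shows "ideal K (free_algebra X)"
proof (rule idealI)
  interpret ring "free_algebra X :: ('x list \<Rightarrow>\<^sub>0 'k) ring" by (rule ring_free_algebra)
  show "ring (free_algebra X :: ('x list \<Rightarrow>\<^sub>0 'k) ring)" by (rule ring_free_algebra)
  show "subgroup K (add_monoid (free_algebra X))"
  proof (rule add.subgroupI)
    show "K \<noteq> {}" using K(2) by blast
  next
    fix f assume f: "f \<in> K"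
    have neg: "- f \<in> K" using left[OF f uminus_one_carrier] by simp
    have "\<ominus>\<^bsub>free_algebra X\<^esub> f = - f"
      using neg f K(1) by (intro minus_equality) (auto simp: free_algebra_def)
    then show "\<ominus>\<^bsub>free_algebra X\<^esub> f \<in> K" using neg by simp
  next
    fix f g assume "f \<in> K" "g \<in> K"
    then show "f \<oplus>\<^bsub>free_algebra X\<^esub> g \<in> K" using add by (simp add: free_algebra_def)
  qed (use K in simp_all)
  show "h \<otimes>\<^bsub>free_algebra X\<^esub> f \<in> K" if "f \<in> K" "h \<in> carrier (free_algebra X)" for f h
    using left[OF that] by (simp add: free_algebra_def)
  show "f \<otimes>\<^bsub>free_algebra X\<^esub> h \<in> K" if "f \<in> K" "h \<in> carrier (free_algebra X)" for f h
    using right[OF that] by (simp add: free_algebra_def)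
qed

section \<open>Linear functionals on the free algebra\<close>

lemma poly_mapping_sum_single:
  fixes f :: "'a \<Rightarrow>\<^sub>0 'b::comm_monoid_add"
  shows "f = (\<Sum>w\<in>Poly_Mapping.keys f. Poly_Mapping.single w (Poly_Mapping.lookup f w))"
proof (rule poly_mapping_eqI)
  fix v
  show "Poly_Mapping.lookup f v = Poly_Mapping.lookup
      (\<Sum>w\<in>Poly_Mapping.keys f. Poly_Mapping.single w (Poly_Mapping.lookup f w)) v"
    by (simp add: lookup_sum lookup_single when_def sum.delta in_keys_iff)
qed

lemma poly_mapping_single_induct [case_names zero single add]:
  fixes f :: "'a \<Rightarrow>\<^sub>0 'b::comm_monoid_add"
  assumes zero: "P 0"
    and single: "\<And>w a. P (Poly_Mapping.single w a)"
    and add: "\<And>f g. P f \<Longrightarrow> P g \<Longrightarrow> P (f + g)"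
  shows "P f"
proof -
  have "P (\<Sum>w\<in>A. Poly_Mapping.single w (Poly_Mapping.lookup f w))" if "finite A" for A
    using that by induction (simp_all add: zero single add)
  from this[OF finite_keys[of f]] show ?thesis by (simp flip: poly_mapping_sum_single)
qed

definition lin_ext :: "('x list \<Rightarrow> 'k) \<Rightarrow> ('x list \<Rightarrow>\<^sub>0 'k::field) \<Rightarrow> 'k" where
  "lin_ext \<psi> f = (\<Sum>w\<in>Poly_Mapping.keys f. Poly_Mapping.lookup f w * \<psi> w)"

text \<open>Allows sums over different supports to be compared over one common finite set.\<close>

lemma lin_ext_superset:
  assumes "finite A" "Poly_Mapping.keys f \<subseteq> A"
  shows "lin_ext \<psi> f = (\<Sum>w\<in>A. Poly_Mapping.lookup f w * \<psi> w)"
  unfolding lin_ext_def using assms by (intro sum.mono_neutral_left) (auto simp: in_keys_iff)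

lemma lin_ext_zero [simp]: "lin_ext \<psi> 0 = 0"
  by (simp add: lin_ext_def)

lemma lin_ext_add: "lin_ext \<psi> (f + g) = lin_ext \<psi> f + lin_ext \<psi> g"
proof -
  let ?A = "Poly_Mapping.keys f \<union> Poly_Mapping.keys g"
  have "lin_ext \<psi> h = (\<Sum>w\<in>?A. Poly_Mapping.lookup h w * \<psi> w)" if "h \<in> {f + g, f, g}" for h
    using that keys_add[of f g] by (intro lin_ext_superset) auto
  then show ?thesis
    by (simp add: lookup_add distrib_right sum.distrib)
qed

lemma lin_ext_single [simp]: "lin_ext \<psi> (Poly_Mapping.single w a) = a * \<psi> w"
  by (simp add: lin_ext_superset[of "{w}"])

lemma lin_ext_word_poly [simp]: "lin_ext \<psi> (word_poly w) = \<psi> w"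
  by (simp add: word_poly_def)

lemma lin_ext_diff: "lin_ext \<psi> (f - g) = lin_ext \<psi> f - lin_ext \<psi> g"
  using lin_ext_add[of \<psi> "f - g" g] by simp

lemma lin_ext_mult_single_left:
  "lin_ext \<psi> (Poly_Mapping.single u a * f) = a * lin_ext (\<lambda>w. \<psi> (u @ w)) f"
  by (induction f rule: poly_mapping_single_induct)
    (simp_all add: mult_single plus_list_def lin_ext_add distrib_left)

lemma lin_ext_mult_single_right:
  "lin_ext \<psi> (f * Poly_Mapping.single u a) = lin_ext (\<lambda>w. \<psi> (w @ u)) f * a"
  by (induction f rule: poly_mapping_single_induct)
    (simp_all add: mult_single plus_list_def lin_ext_add distrib_right)

text \<open>The polynomials annihilated by all shifted functionals
  \<open>\<lambda>w. \<psi> (p @ w @ q)\<close> form a two-sided ideal, since multiplication by a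
  monomial merely lengthens \<open>p\<close> or \<open>q\<close>. This ideal contains
  \<open>S\<close>, and the shift by two empty words gives the claim.\<close>

lemma lin_ext_genideal:
  fixes S :: "('x list \<Rightarrow>\<^sub>0 'k::field) set"
  assumes S: "S \<subseteq> carrier (free_algebra X)"
    and zero: "\<And>f p q. f \<in> S \<Longrightarrow> lin_ext (\<lambda>w. \<psi> (p @ w @ q)) f = 0"
    and f: "f \<in> Idl\<^bsub>free_algebra X\<^esub> S"
  shows "lin_ext \<psi> f = 0"
proof -
  define K where "K = {f \<in> carrier (free_algebra X). \<forall>p q. lin_ext (\<lambda>w. \<psi> (p @ w @ q)) f = 0}"
  interpret ring "free_algebra X :: ('x list \<Rightarrow>\<^sub>0 'k) ring" by (rule ring_free_algebra)
  have closed: "0 \<in> carrier (free_algebra X)" "g + h \<in> carrier (free_algebra X)"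
      "g * h \<in> carrier (free_algebra X)"
    if "g \<in> carrier (free_algebra X)" "h \<in> carrier (free_algebra X)"
    for g h :: "'x list \<Rightarrow>\<^sub>0 'k"
    using that zero_closed a_closed[OF that] m_closed[OF that] by (simp_all add: free_algebra_def)
  have left: "lin_ext (\<lambda>w. \<psi> (p @ w @ q)) (h * g) = 0" if "g \<in> K" for g h p q
    by (induction h rule: poly_mapping_single_induct)
      (use that in \<open>simp_all add: lin_ext_mult_single_left distrib_right lin_ext_add K_def
        flip: append_assoc\<close>)
  have right: "lin_ext (\<lambda>w. \<psi> (p @ w @ q)) (g * h) = 0" if "g \<in> K" for g h p q
    by (induction h rule: poly_mapping_single_induct)
      (use that in \<open>simp_all add: lin_ext_mult_single_right distrib_left lin_ext_add K_def\<close>)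
  have "ideal K (free_algebra X)"
  proof (rule ideal_free_algebraI)
    show "0 \<in> K" using closed(1) zero_closed by (auto simp: K_def)
    show "g + h \<in> K" if "g \<in> K" "h \<in> K" for g h
      using that closed(2) by (simp add: K_def lin_ext_add)
    show "h * g \<in> K" if "g \<in> K" "h \<in> carrier (free_algebra X)" for g h
      using that closed(3) left[OF that(1)] by (simp add: K_def)
    show "g * h \<in> K" if "g \<in> K" "h \<in> carrier (free_algebra X)" for g h
      using that closed(3) right[OF that(1)] by (simp add: K_def)
  qed (simp add: K_def)
  moreover have "S \<subseteq> K" using S zero by (auto simp: K_def)
  ultimately have "f \<in> K" using f genideal_minimal by blast
  then have "lin_ext (\<lambda>w. \<psi> ([] @ w @ [])) f = 0" unfolding K_def by blast
  then show ?thesis by simp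
qed

section \<open>Leading words\<close>

lemma finite_relation_greatest:
  assumes "finite A" "A \<noteq> {}" "A \<subseteq> B" "trans O'" "total_on B O'"
  shows "\<exists>w\<in>A. \<forall>v\<in>A. v \<noteq> w \<longrightarrow> (v, w) \<in> O'"
  using assms(1-3)
proof (induction rule: finite_ne_induct)
  case (insert a A)
  then obtain w where w: "w \<in> A" "\<forall>v\<in>A. v \<noteq> w \<longrightarrow> (v, w) \<in> O'" by auto
  have "a \<noteq> w" using w(1) insert.hyps by blast
  then consider "(a, w) \<in> O'" | "(w, a) \<in> O'"
    using assms(5) w(1) insert.prems unfolding total_on_def by blast
  then show ?case
  proof cases
    case 2
    have "(v, a) \<in> O'" if "v \<in> A" for v
      using w(2) 2 that transD[OF assms(4), of v w a] by (cases "v = w") auto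
    then show ?thesis by blast
  qed (use w in blast)
qed simp

locale word_order =
  fixes X :: "'x set" and O' :: "'x list rel"
  assumes trans: "trans O'" and irrefl: "irrefl O'" and total: "total_on (lists X) O'"
begin

lemma asym: "(u, v) \<in> O' \<Longrightarrow> (v, u) \<notin> O'"
  using transD[OF trans, of u v u] irrefl by (auto simp: irrefl_def)

lemma lm_eqI:
  assumes "w \<in> Poly_Mapping.keys f" "\<And>v. v \<in> Poly_Mapping.keys f \<Longrightarrow> v \<noteq> w \<Longrightarrow> (v, w) \<in> O'"
  shows "lm O' f = w"
  unfolding lm_def
proof (rule the_equality)
  show "u = w" if "u \<in> Poly_Mapping.keys f \<and> (\<forall>v\<in>Poly_Mapping.keys f. v \<noteq> u \<longrightarrow> (v, u) \<in> O')" for u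
    using that assms asym[of u w] by metis
qed (use assms in blast)

lemma lm_greatest:
  assumes "f \<in> carrier (free_algebra X)" "f \<noteq> 0"
  shows "lm O' f \<in> Poly_Mapping.keys f"
    "v \<in> Poly_Mapping.keys f \<Longrightarrow> v \<noteq> lm O' f \<Longrightarrow> (v, lm O' f) \<in> O'"
proof -
  obtain w where w: "w \<in> Poly_Mapping.keys f" "\<forall>v\<in>Poly_Mapping.keys f. v \<noteq> w \<longrightarrow> (v, w) \<in> O'"
    using finite_relation_greatest[OF _ _ _ trans total, of "Poly_Mapping.keys f"] assms
    by (auto simp: carrier_free_algebra_iff)
  have "lm O' f = w" using w by (intro lm_eqI) auto
  with w show "lm O' f \<in> Poly_Mapping.keys f"
    "v \<in> Poly_Mapping.keys f \<Longrightarrow> v \<noteq> lm O' f \<Longrightarrow> (v, lm O' f) \<in> O'" by auto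
qed

lemma lm_word_poly: "lm O' (word_poly w) = w"
  by (rule lm_eqI) (simp_all add: word_poly_def)

lemma lm_binomial:
  assumes "(v, u) \<in> O'"
  shows "lm O' (word_poly u - word_poly v) = u"
proof -
  have "u \<noteq> v" using assms irrefl by (auto simp: irrefl_def)
  then have "Poly_Mapping.keys (word_poly u - word_poly v :: 'x list \<Rightarrow>\<^sub>0 'k::field) = {u, v}"
    by (auto simp: in_keys_iff word_poly_def lookup_minus lookup_single when_def split: if_splits)
  then show ?thesis using assms by (intro lm_eqI) auto
qed

text \<open>The coefficient of \<open>lm f\<close> in the image of \<open>f\<close> under the linear extension of \<open>NF\<close> can only
  come from \<open>lm f\<close> itself, because \<open>NF\<close> never makes a word larger.\<close>

lemma lm_not_fixed:
  fixes S :: "('x list \<Rightarrow>\<^sub>0 'k::field) set" and NF :: "'x list \<Rightarrow> 'x list option"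
  assumes S: "S \<subseteq> carrier (free_algebra X)"
    and invariant: "\<And>f p q c. f \<in> S \<Longrightarrow> lin_ext (\<lambda>w. of_bool (NF (p @ w @ q) = Some c)) f = 0"
    and decreasing: "\<And>v c. v \<in> lists X \<Longrightarrow> NF v = Some c \<Longrightarrow> c = v \<or> (c, v) \<in> O'"
    and f: "f \<in> Idl\<^bsub>free_algebra X\<^esub> S" "f \<noteq> 0"
  shows "NF (lm O' f) \<noteq> Some (lm O' f)"
proof
  let ?w = "lm O' f"
  assume fixed: "NF ?w = Some ?w"
  interpret ring "free_algebra X :: ('x list \<Rightarrow>\<^sub>0 'k) ring" by (rule ring_free_algebra)
  have carr: "f \<in> carrier (free_algebra X)"
    by (rule ideal.Icarr[OF genideal_ideal[OF S] f(1)])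
  have other: "NF v \<noteq> Some ?w" if "v \<in> Poly_Mapping.keys f" "v \<noteq> ?w" for v
  proof -
    have "v \<in> lists X" using that(1) carr by (auto simp: carrier_free_algebra_iff)
    moreover have "(?w, v) \<notin> O'" using asym lm_greatest(2)[OF carr f(2) that] by blast
    ultimately show ?thesis using decreasing[of v ?w] that(2) by metis
  qed
  have "0 = lin_ext (\<lambda>w. of_bool (NF w = Some ?w)) f"
    using lin_ext_genideal[where \<psi> = "\<lambda>w. of_bool (NF w = Some ?w)", OF S invariant f(1)] by simp
  also have "\<dots> = (\<Sum>v\<in>Poly_Mapping.keys f. if v = ?w then Poly_Mapping.lookup f ?w else 0)"
    unfolding lin_ext_def using fixed other by (intro sum.cong) auto
  also have "\<dots> = Poly_Mapping.lookup f ?w"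
    using lm_greatest(1)[OF carr f(2)] by simp
  finally show False using lm_greatest(1)[OF carr f(2)] by (simp add: in_keys_iff)
qed

end

section \<open>Groebner bases by subword divisibility; the degree-lexicographic order\<close>

text \<open>If \<open>lm g\<close> is a subword of \<open>lm f\<close>, multiplying the word
  \<open>lm g\<close> from both sides yields \<open>lm f\<close>. Hence all leading words of
  \<open>I\<close> lie in the monomial ideal of \<open>U\<close>; the other inclusion comes from
  \<open>U \<subseteq> I\<close>.\<close>

lemma groebner_basis_sublistI:
  fixes U I :: "('x list \<Rightarrow>\<^sub>0 'k::field) set"
  assumes "word_order X O'" "ideal I (free_algebra X)" "U \<subseteq> I"
    and reducible: "\<And>f. f \<in> I \<Longrightarrow> f \<noteq> 0 \<Longrightarrow> \<exists>g\<in>U. g \<noteq> 0 \<and> sublist (lm O' g) (lm O' f)"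
  shows "is_groebner_basis X O' I U"
proof -
  interpret word_order X O' by fact
  interpret ring "free_algebra X :: ('x list \<Rightarrow>\<^sub>0 'k) ring" by (rule ring_free_algebra)
  have lmX: "lm O' f \<in> lists X" if "f \<in> I" "f \<noteq> 0" for f
    using lm_greatest(1)[OF _ that(2)] ideal.Icarr[OF assms(2) that(1)]
    by (auto simp: carrier_free_algebra_iff)
  let ?lms = "\<lambda>S. {word_poly (lm O' f) :: 'x list \<Rightarrow>\<^sub>0 'k |f. f \<in> S \<and> f \<noteq> 0}"
  have carr: "?lms U \<subseteq> carrier (free_algebra X)" "?lms I \<subseteq> carrier (free_algebra X)"
    using lmX assms(3) by auto
  have idealU: "ideal (lm_ideal X O' U) (free_algebra X)"
    unfolding lm_ideal_def using carr(1) by (rule genideal_ideal)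
  have "?lms I \<subseteq> lm_ideal X O' U"
  proof
    fix h assume "h \<in> ?lms I"
    then obtain f where f: "f \<in> I" "f \<noteq> 0" and h: "h = word_poly (lm O' f)" by blast
    obtain g where g: "g \<in> U" "g \<noteq> 0" "sublist (lm O' g) (lm O' f)" using reducible[OF f] by blast
    obtain p q where pq: "lm O' f = p @ lm O' g @ q" using g(3) by (auto simp: sublist_def)
    have "word_poly (lm O' g) \<in> lm_ideal X O' U"
      unfolding lm_ideal_def using g genideal_self[OF carr(1)] by blast
    from ideal_free_algebra_sandwich[OF idealU this, of p q] lmX[OF f] pq
    show "h \<in> lm_ideal X O' U" by (simp add: h word_poly_mult)
  qed
  then have "lm_ideal X O' I \<subseteq> lm_ideal X O' U"
    unfolding lm_ideal_def using idealU[unfolded lm_ideal_def] genideal_minimal by blast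
  moreover have "lm_ideal X O' U \<subseteq> lm_ideal X O' I"
    unfolding lm_ideal_def using assms(3) carr(2) by (intro subset_Idl_subset) blast+
  ultimately show ?thesis using assms(3) by (auto simp: is_groebner_basis_def)
qed

lemma word_order_deglex:
  assumes "linear_order_on X r"
  shows "word_order X (deglex X wt r)"
proof -
  have r: "trans r" "antisym r" "total_on X r"
    using assms by (simp_all add: linear_order_on_def partial_order_on_def preorder_on_def)
  have tr: "trans (r - Id)" using r by (simp add: trans_diff_Id)
  show ?thesis
  proof
    show "trans (deglex X wt r)"
      by (rule transI) (auto simp: deglex_def dest: lexord_trans[OF _ _ tr])
    show "irrefl (deglex X wt r)"
      by (auto simp: irrefl_def deglex_def lexord_irreflexive)
    \<comment> \<open>The lexicographic part alone compares any two distinct words over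
      \<open>X\<close>, at the first differing letter or as proper prefix and extension; so every
      tie of degrees is broken.\<close>
    have "(u, v) \<in> lexord (r - Id) \<or> (v, u) \<in> lexord (r - Id)"
      if "u \<in> lists X" "v \<in> lists X" "u \<noteq> v" for u v
      using that
    proof (induction u arbitrary: v)
      case Nil
      then show ?case by (cases v) auto
    next
      case (Cons a u)
      then show ?case using r(3) by (cases v) (auto simp: total_on_def)
    qed
    then show "total_on (lists X) (deglex X wt r)"
      unfolding total_on_def deglex_def by (auto simp del: in_lists_conv_set)
  qed
qed

section \<open>Dyck words\<close>

lemma dyck_parens: "w \<in> dyck n \<Longrightarrow> w \<in> lists (parens n)"
  by (induction rule: dyck.induct) (auto simp: parens_def)

lemma lang_P_Nil: "[] \<in> lang_P n"
  unfolding lang_P_def kleene_star_def by (rule image_eqI[of _ _ "[]"]) auto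

lemma lang_P_Cons: "w \<in> dyck n \<Longrightarrow> p \<in> lang_P n \<Longrightarrow> w @ Le # p \<in> lang_P n"
  unfolding lang_P_def kleene_star_def
  by (elim imageE, rule_tac x = "(w @ [Le]) # x" in image_eqI) auto

text \<open>The Kleene star is unrolled from the left, one block \<open>w @ [Le]\<close> at a time,
  because both the raised letters and the insertion of Dyck words work on the leftmost
  block.\<close>

lemma lang_P_induct [consumes 1, case_names Nil Cons]:
  assumes "p \<in> lang_P n" "Q []"
    and step: "\<And>w p. w \<in> dyck n \<Longrightarrow> p \<in> lang_P n \<Longrightarrow> Q p \<Longrightarrow> Q (w @ Le # p)"
  shows "Q p"
proof -
  have "concat us \<in> lang_P n \<and> Q (concat us)" if "us \<in> lists {w @ [Le] |w. w \<in> dyck n}" for us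
    using that
  proof induction
    case (Cons u us)
    then show ?case using step lang_P_Cons by auto
  qed (simp add: assms(2) lang_P_Nil)
  then show ?thesis using assms(1) unfolding lang_P_def kleene_star_def by blast
qed

lemma lang_P_cases [consumes 1, case_names Nil Cons]:
  assumes "p \<in> lang_P n"
  obtains "p = []" | w p' where "p = w @ Le # p'" "w \<in> dyck n" "p' \<in> lang_P n"
proof -
  have "p = [] \<or> (\<exists>w p'. p = w @ Le # p' \<and> w \<in> dyck n \<and> p' \<in> lang_P n)"
    using assms by (induction rule: lang_P_induct) blast+
  then show ?thesis using that by blast
qed

lemma lang_P_letters: "p \<in> lang_P n \<Longrightarrow> set p \<subseteq> insert Le (parens n)"
  by (induction rule: lang_P_induct) (use dyck_parens in auto)

text \<open>Ensures that in x p y v e the letter y never follows a parenthesis, so that no rule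
  moving y to the left applies there.\<close>

lemma lang_P_snoc: "p \<in> lang_P n \<Longrightarrow> p = [] \<or> (\<exists>q. p = q @ [Le])"
  by (induction rule: lang_P_induct) auto

section \<open>The action on words\<close>

text \<open>Treats opening and closing parentheses uniformly, so that the six families in (ii)
  become two rules. On other letters the value is a dummy.\<close>

fun raised :: "letter \<Rightarrow> nat \<Rightarrow> letter" where
  "raised (La i) j = Laj i j"
| "raised (Lb i) j = Lbj i j"
| "raised c j = c"

text \<open>A pair is a rewriting rule: the second component replaces the first, and
  \<open>None\<close> stands for zero.\<close>

definition rule_poly :: "'x list \<times> 'x list option \<Rightarrow> ('x list \<Rightarrow>\<^sub>0 'k::field)" where
  "rule_poly \<rho> = word_poly (fst \<rho>) - (case snd \<rho> of None \<Rightarrow> 0 | Some v \<Rightarrow> word_poly v)"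

lemma parens_cases:
  assumes "c \<in> parens n"
  obtains i where "c = La i" "i \<in> {1..n}" | i where "c = Lb i" "i \<in> {1..n}"
  using assms by (auto simp: parens_def)

lemma parens_simps [simp]:
  "La i \<in> parens n \<longleftrightarrow> i \<in> {1..n}" "Lb i \<in> parens n \<longleftrightarrow> i \<in> {1..n}"
  "Laj i j \<notin> parens n" "Lbj i j \<notin> parens n"
  "Lx \<notin> parens n" "Ly \<notin> parens n" "Le \<notin> parens n" "Lt k \<notin> parens n"
  by (auto simp: parens_def)

lemma letters_simps [simp]:
  "La i \<in> letters n m \<longleftrightarrow> i \<in> {1..n}" "Lb i \<in> letters n m \<longleftrightarrow> i \<in> {1..n}"
  "Laj i j \<in> letters n m \<longleftrightarrow> i \<in> {1..n} \<and> j \<in> {1..n}"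
  "Lbj i j \<in> letters n m \<longleftrightarrow> i \<in> {1..n} \<and> j \<in> {1..n}"
  "Lx \<in> letters n m" "Ly \<in> letters n m" "Le \<in> letters n m"
  "Lt k \<in> letters n m \<longleftrightarrow> k \<in> {1..m}"
  by (auto simp: letters_def parens_def terminals_def)

lemma parens_letters: "c \<in> parens n \<Longrightarrow> c \<in> letters n m"
  by (simp add: letters_def)

lemma terminals_letters: "c \<in> terminals m \<Longrightarrow> c \<in> letters n m"
  by (simp add: letters_def)

lemma raised_letters: "c \<in> parens n \<Longrightarrow> j \<in> {1..n} \<Longrightarrow> raised c j \<in> letters n m"
  by (erule parens_cases) auto

lemma letters_cases:
  assumes "c \<in> letters n m"
  obtains "c \<in> parens n"
  | c' j where "c = raised c' j" "c' \<in> parens n" "j \<in> {1..n}"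
  | "c = Lx" | "c = Ly" | "c = Le" | "c \<in> terminals m"
proof -
  have "c \<in> parens n \<or> (\<exists>c' j. c = raised c' j \<and> c' \<in> parens n \<and> j \<in> {1..n}) \<or>
      c = Lx \<or> c = Ly \<or> c = Le \<or> c \<in> terminals m"
    using assms unfolding letters_def
    by (auto intro: exI[of _ "La i" for i] exI[of _ "Lb i" for i])
  then show ?thesis using that by blast
qed

locale dyck_presentation =
  fixes n m d :: nat and \<phi> :: "letter list \<Rightarrow> letter list" and r :: "letter rel"
  assumes n_pos: "n \<ge> 1"
    and hom: "word_hom (parens n) (terminals m) \<phi>"
    and length_le: "\<And>c. c \<in> parens n \<Longrightarrow> length (\<phi> [c]) \<le> d"
    and d_pos: "d \<ge> 1"
    and order: "admissible_letter_order n m r"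
begin

abbreviation "X \<equiv> letters n m"
abbreviation "wless \<equiv> deglex X (letter_degree d) r"
abbreviation "deg w \<equiv> sum_list (map (letter_degree d) w)"

lemma phi_Nil [simp]: "\<phi> [] = []"
  and phi_terminals: "u \<in> lists (parens n) \<Longrightarrow> \<phi> u \<in> lists (terminals m)"
  and phi_append: "u \<in> lists (parens n) \<Longrightarrow> v \<in> lists (parens n) \<Longrightarrow> \<phi> (u @ v) = \<phi> u @ \<phi> v"
  using hom by (simp_all add: word_hom_def)

lemma phi_Cons: "c \<in> parens n \<Longrightarrow> w \<in> lists (parens n) \<Longrightarrow> \<phi> (c # w) = \<phi> [c] @ \<phi> w"
  using phi_append[of "[c]" w] by simp

text \<open>The relations (i)-(iii), oriented from the leading word to the rest. Relation (iv) is
  instead the member of \<open>accept_rules\<close> with \<open>p\<close> and \<open>v\<close>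
  empty.\<close>

inductive_set basic_rules :: "(letter list \<times> letter list option) set" where
  commute: "i \<in> {1..n} \<Longrightarrow> ([Laj i i, Lx], Some [Lx, Laj i i]) \<in> basic_rules"
| create: "([Lbj 1 1, Lx], Some [Lx, Le]) \<in> basic_rules"
| move: "c \<in> parens n \<Longrightarrow> c' \<in> parens n \<Longrightarrow> j \<in> {1..n} \<Longrightarrow>
    ([raised c j, c'], Some [c, raised c' j]) \<in> basic_rules"
| close: "c \<in> parens n \<Longrightarrow> j \<in> {1..n} \<Longrightarrow> ([raised c j, Le], Some [c, Lb j]) \<in> basic_rules"
| translate: "c \<in> parens n \<Longrightarrow> ([c, Ly], Some (Ly # \<phi> [c])) \<in> basic_rules"
| kill: "c \<in> parens n \<Longrightarrow> j \<in> {1..n} \<Longrightarrow> ([raised c j, Ly], None) \<in> basic_rules"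

definition accept_rules :: "(letter list \<times> letter list option) set" where
  "accept_rules = {([Lx] @ p @ [Ly] @ v @ [Le], None) |p v. p \<in> lang_P n \<and> v \<in> \<phi> ` dyck n}"

text \<open>The words that x sends to zero: putting x in front of them creates a left-hand side of
  \<open>accept_rules\<close> as a prefix.\<close>

definition accepted :: "letter list set" where
  "accepted = {p @ [Ly] @ v @ [Le] @ s |p v s. p \<in> lang_P n \<and> v \<in> \<phi> ` dyck n}"

text \<open>\<open>act c s\<close> is the intended normal form of \<open>c # s\<close> when \<open>s\<close> is in normal form, with
  \<^const>\<open>None\<close> for the zero of the algebra. The basic relations and \<open>xye = 0\<close> hold as identities
  between these operators on \<^emph>\<open>all\<close> words, so confluence needs no separate treatment.\<close>

definition act_x :: "letter list \<Rightarrow> letter list option" where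
  "act_x s = (if s \<in> accepted then None else Some (Lx # s))"

definition act_paren :: "letter \<Rightarrow> letter list \<Rightarrow> letter list" where
  "act_paren c s = (if s \<noteq> [] \<and> hd s = Ly then Ly # \<phi> [c] @ tl s else c # s)"

text \<open>The upper index \<open>j\<close> travels to the right through parentheses until it meets
  e, which becomes \<open>Lb j\<close>, or y, which gives zero. Behind x it goes on travelling only
  for \<open>c = La j\<close>. Letters are put back by \<open>act_paren\<close> and
  \<open>act_x\<close>, since the changed tail may start with y or have become accepted.\<close>

primrec act_raised :: "letter list \<Rightarrow> letter \<Rightarrow> nat \<Rightarrow> letter list option" where
  "act_raised [] c j = Some [raised c j]"
| "act_raised (s0 # s) c j =
    (if s0 \<in> parens n then map_option (act_paren c) (act_raised s s0 j)
     else if s0 = Le then Some (act_paren c (act_paren (Lb j) s))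
     else if s0 = Ly then None
     else if s0 = Lx \<and> c = La j then Option.bind (act_raised s c j) act_x
     else if s0 = Lx \<and> c = Lb 1 \<and> j = 1 then act_x (Le # s)
     else Some (raised c j # s0 # s))"

fun act :: "letter \<Rightarrow> letter list \<Rightarrow> letter list option" where
  "act (La i) s = Some (act_paren (La i) s)"
| "act (Lb i) s = Some (act_paren (Lb i) s)"
| "act (Laj i j) s = act_raised s (La i) j"
| "act (Lbj i j) s = act_raised s (Lb i) j"
| "act Lx s = act_x s"
| "act c s = Some (c # s)"

text \<open>For \<open>z = Some []\<close> this is the intended normal form of \<open>w\<close>; a
  general \<open>z\<close> makes reduction compatible with concatenation.\<close>

definition reduce :: "letter list \<Rightarrow> letter list option \<Rightarrow> letter list option" where
  "reduce w z = foldr (\<lambda>c z. Option.bind z (act c)) w z"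

lemma reduce_simps [simp]:
  "reduce [] z = z" "reduce (c # w) z = Option.bind (reduce w z) (act c)"
  "reduce (u @ v) z = reduce u (reduce v z)"
  by (simp_all add: reduce_def)

lemma reduce_None [simp]: "reduce w None = None"
  by (induction w) simp_all

lemma act_parens: "c \<in> parens n \<Longrightarrow> act c s = Some (act_paren c s)"
  by (erule parens_cases) simp_all

lemma act_raised_letter: "c \<in> parens n \<Longrightarrow> act (raised c j) s = act_raised s c j"
  by (erule parens_cases) simp_all

lemma act_terminals: "c \<in> terminals m \<Longrightarrow> act c s = Some (c # s)"
  by (auto simp: terminals_def)

lemma reduce_terminals: "v \<in> lists (terminals m) \<Longrightarrow> reduce v (Some s) = Some (v @ s)"
  by (induction v) (simp_all add: act_terminals)

lemma reduce_parens_y: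
  "w \<in> lists (parens n) \<Longrightarrow> reduce w (Some (Ly # s)) = Some (Ly # \<phi> w @ s)"
proof (induction w)
  case (Cons c w)
  then show ?case using phi_Cons[of c w] by (simp add: act_parens act_paren_def)
qed simp

lemma reduce_parens:
  "w \<in> lists (parens n) \<Longrightarrow> s = [] \<or> hd s \<noteq> Ly \<Longrightarrow> reduce w (Some s) = Some (w @ s)"
proof (induction w)
  case (Cons c w)
  then have "w @ s = [] \<or> hd (w @ s) \<noteq> Ly" by (cases w) auto
  then show ?case using Cons by (auto simp: act_parens act_paren_def)
qed simp

text \<open>On a word starting with y both sides vanish: on the left \<open>c'\<close> is translated
  behind y and \<open>raised c j\<close> meets y, on the right \<open>raised c' j\<close> meets it
  directly. On all other words this is the recursion of \<open>act_raised\<close>.\<close>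

lemma reduce_move:
  assumes "c \<in> parens n" "c' \<in> parens n"
  shows "reduce [raised c j, c'] z = reduce [c, raised c' j] z"
proof (cases z)
  case (Some s)
  show ?thesis
  proof (cases "s \<noteq> [] \<and> hd s = Ly")
    case True
    then obtain t where "s = Ly # t" by (cases s) auto
    then show ?thesis
      using Some assms by (simp add: act_parens act_raised_letter act_paren_def)
  next
    case False
    then show ?thesis using Some assms
      by (cases "act_raised s c' j")
        (simp_all add: act_parens act_raised_letter act_paren_def[of c'])
  qed
qed simp

lemma reduce_close:
  assumes "c \<in> parens n" "j \<in> {1..n}"
  shows "reduce [raised c j, Le] z = reduce [c, Lb j] z"
  using assms by (cases z) (simp_all add: act_parens act_raised_letter)

text \<open>The index passes through \<open>w\<close> letter by letter by
  \<open>reduce_move\<close>, until \<open>reduce_close\<close> turns e into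
  \<open>Lb j\<close>.\<close>

lemma reduce_raised_word:
  assumes "w \<in> lists (parens n)" "c \<in> parens n" "j \<in> {1..n}"
  shows "reduce (raised c j # w @ [Le]) z = reduce (c # w @ [Lb j]) z"
  using assms
proof (induction w arbitrary: c)
  case Nil
  then show ?case using reduce_close[of c j z] by simp
next
  case (Cons c' w)
  have "reduce (raised c j # (c' # w) @ [Le]) z = reduce [raised c j, c'] (reduce (w @ [Le]) z)"
    by simp
  also have "\<dots> = reduce [c, raised c' j] (reduce (w @ [Le]) z)"
    using Cons.hyps Cons.prems by (intro reduce_move) auto
  also have "\<dots> = reduce [c] (reduce (raised c' j # w @ [Le]) z)"
    by simp
  also have "\<dots> = reduce [c] (reduce (c' # w @ [Lb j]) z)"
    using Cons by simp
  finally show ?case by simp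
qed

text \<open>The empty Dyck word followed by e is a block of P_n.\<close>

lemma accepted_Le: "s \<in> accepted \<Longrightarrow> Le # s \<in> accepted"
proof -
  assume "s \<in> accepted"
  then obtain p v t where s: "s = p @ [Ly] @ v @ [Le] @ t" "p \<in> lang_P n" "v \<in> \<phi> ` dyck n"
    unfolding accepted_def by blast
  have "Le # s = (Le # p) @ [Ly] @ v @ [Le] @ t" using s(1) by simp
  then show ?thesis
    using lang_P_Cons[OF dyck.Nil s(2)] s(3) unfolding accepted_def append_Nil by blast
qed

text \<open>The index of a_i^i runs through the first block w e and turns it into the Dyck word a_i
  w b_i, which is absorbed by what follows.\<close>

lemma accepted_raised:
  assumes "s \<in> accepted" "i \<in> {1..n}" "act_raised s (La i) i = Some s'"
  shows "s' \<in> accepted"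
proof -
  obtain p v t where s: "s = p @ [Ly] @ v @ [Le] @ t" "p \<in> lang_P n" "v \<in> \<phi> ` dyck n"
    using assms(1) unfolding accepted_def by blast
  obtain u where u: "v = \<phi> u" "u \<in> dyck n" using s(3) by blast
  \<comment> \<open>For empty \<open>p\<close> the word starts with y, where the raised letter gives
    zero.\<close>
  have "p \<noteq> []" using assms(3) s(1) by auto
  with s(2) obtain w p' where p: "p = w @ Le # p'" "w \<in> dyck n" "p' \<in> lang_P n"
    by (cases rule: lang_P_cases) auto
  let ?t = "p' @ [Ly] @ v @ [Le] @ t" and ?w = "La i # w @ [Lb i]"
  have w: "?w \<in> dyck n" "?w \<in> lists (parens n)" "w \<in> lists (parens n)"
    using dyck.nest[OF p(2) assms(2)] dyck_parens p(2) by blast+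
  have "Some s' = reduce (raised (La i) i # w @ [Le]) (Some ?t)"
    using reduce_parens[OF w(3), of "Le # ?t"] assms(3) s(1) p(1) by simp
  also have "\<dots> = reduce ?w (Some ?t)"
    using w(3) assms(2) by (intro reduce_raised_word) auto
  finally have s': "reduce ?w (Some ?t) = Some s'" by simp
  from p(3) show ?thesis
  proof (cases rule: lang_P_cases)
    \<comment> \<open>The new Dyck word now stands directly before y; it is translated and joins the
      part in L.\<close>
    case Nil
    have "s' = [] @ [Ly] @ \<phi> (?w @ u) @ [Le] @ t"
      using s' reduce_parens_y[OF w(2), of "v @ [Le] @ t"] phi_append[OF w(2) dyck_parens[OF u(2)]] Nil u(1)
      by (simp del: reduce_simps)
    then show ?thesis
      unfolding accepted_def using lang_P_Nil dyck.append[OF w(1) u(2)] by blast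
  next
    \<comment> \<open>The new Dyck word is concatenated with that of the next block.\<close>
    case (Cons w' q)
    have "hd ?t \<noteq> Ly"
      using Cons(1) dyck_parens[OF Cons(2)] by (cases w') auto
    then have "s' = ((?w @ w') @ Le # q) @ [Ly] @ v @ [Le] @ t"
      using s' reduce_parens[OF w(2), of ?t] Cons(1) by (simp del: reduce_simps)
    then show ?thesis
      unfolding accepted_def using lang_P_Cons[OF dyck.append[OF w(1) Cons(2)] Cons(3)] s(3) by blast
  qed
qed

text \<open>For \<open>commute\<close> and \<open>create\<close> the delicate case is an accepted
  \<open>s\<close>: the left side is zero because x kills \<open>s\<close>, and the right side is
  zero by \<open>accepted_raised\<close> and \<open>accepted_Le\<close>.\<close>

lemma reduce_basic_rule:
  assumes "(u, z) \<in> basic_rules"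
  shows "reduce u (Some s) = Option.bind z (\<lambda>v. reduce v (Some s))"
  using assms
proof cases
  case (commute i)
  then show ?thesis using accepted_raised[of s i]
    by (cases "act_raised s (La i) i") (auto simp: act_x_def)
next
  case create
  then show ?thesis using accepted_Le[of s] by (auto simp: act_x_def)
next
  case (move c c' j)
  then show ?thesis using reduce_move[of c c' j "Some s"] by simp
next
  case (close c j)
  then show ?thesis using reduce_close[of c j "Some s"] by simp
next
  case (translate c)
  then show ?thesis using phi_terminals[of "[c]"] by (simp add: reduce_terminals act_parens act_paren_def)
next
  case (kill c j)
  then show ?thesis by (simp add: act_raised_letter)
qed

lemma reduce_xye: "reduce [Lx, Ly, Le] (Some s) = None"
proof -
  have "[] @ [Ly] @ \<phi> [] @ [Le] @ s \<in> accepted"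
    unfolding accepted_def using lang_P_Nil dyck.Nil by blast
  then show ?thesis by (simp add: act_x_def)
qed

section \<open>Reduction does not increase words\<close>

text \<open>Each branch of the action that does more than prepend \<open>c\<close> is entered only
  if \<open>c # s\<close> begins with the left-hand side of a rule.\<close>

lemma act_irreducible:
  assumes "c \<in> X" "s \<in> lists X" and irr: "\<And>\<rho>. \<rho> \<in> basic_rules \<union> accept_rules \<Longrightarrow> \<not> prefix (fst \<rho>) (c # s)"
  shows "act c s = Some (c # s)"
  using assms(1)
proof (cases rule: letters_cases)
  case 1
  have "s = [] \<or> hd s \<noteq> Ly"
    using irr[of "([c, Ly], Some (Ly # \<phi> [c]))"] basic_rules.translate[OF 1] by (cases s) auto
  then show ?thesis using 1 by (auto simp: act_parens act_paren_def)
next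
  case (2 c' j)
  show ?thesis
  proof (cases s)
    case Nil
    then show ?thesis using 2 by (simp add: act_raised_letter)
  next
    case (Cons s0 s')
    have *: "([c, s0], z) \<notin> basic_rules" for z
      using irr[of "([c, s0], z)"] Cons by auto
    have "s0 \<notin> parens n" "s0 \<noteq> Le" "s0 \<noteq> Ly" "\<not> (s0 = Lx \<and> c' = La j)"
      "\<not> (s0 = Lx \<and> c' = Lb 1 \<and> j = 1)"
      using * basic_rules.move[OF 2(2) _ 2(3), of s0] basic_rules.close[OF 2(2,3)]
        basic_rules.kill[OF 2(2,3)] basic_rules.commute[OF 2(3)] basic_rules.create
      unfolding 2(1) by (auto simp del: One_nat_def)
    then show ?thesis using 2 Cons by (auto simp: act_raised_letter)
  qed
next
  case 3
  have "s \<notin> accepted"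
    using irr 3 unfolding accepted_def accept_rules_def by fastforce
  then show ?thesis using 3 by (simp add: act_x_def)
qed (auto simp: act_terminals)

lemma reduce_irreducible:
  assumes "w \<in> lists X" "\<And>\<rho>. \<rho> \<in> basic_rules \<union> accept_rules \<Longrightarrow> \<not> sublist (fst \<rho>) w"
  shows "reduce w (Some []) = Some w"
  using assms
proof (induction w)
  case (Cons c w)
  have "reduce w (Some []) = Some w"
    using Cons.prems by (intro Cons.IH) (simp add: sublist_Cons_right)
  moreover have "act c w = Some (c # w)"
    using Cons.prems by (intro act_irreducible[OF Cons.hyps]) (simp add: sublist_Cons_right)
  ultimately show ?case by simp
qed simp

lemma linear_order: "linear_order_on X r"
  using order by (simp add: admissible_letter_order_def)

sublocale word_order X wless
  by (rule word_order_deglex[OF linear_order])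

lemma wless_Cons: "(u, v) \<in> wless \<Longrightarrow> c \<in> X \<Longrightarrow> (c # u, c # v) \<in> wless"
  by (auto simp: deglex_def)

lemma wless_hd:
  assumes "(a, b) \<in> r" "a \<noteq> b" "a # u \<in> lists X" "b # v \<in> lists X" "deg (a # u) \<le> deg (b # v)"
  shows "(a # u, b # v) \<in> wless"
  using assms by (auto simp: deglex_def)

lemma letter_order:
  shows "c \<in> parens n \<Longrightarrow> j \<in> {1..n} \<Longrightarrow> (c, raised c j) \<in> r"
    and "c \<in> parens n \<Longrightarrow> j \<in> {1..n} \<Longrightarrow> (Lx, raised c j) \<in> r"
    and "c \<in> parens n \<Longrightarrow> (Ly, c) \<in> r"
proof -
  have tr: "trans r"
    using linear_order by (simp add: linear_order_on_def partial_order_on_def preorder_on_def)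
  \<comment> \<open>The order is prescribed between neighbouring kinds of letters only. The chains
    between distant kinds pass through letters with some index, and 1 is available.\<close>
  have one: "1 \<in> {1..n}" using n_pos by simp
  have ord: "(La k, Lbj i j) \<in> r" "(Lbj k l, Laj i j) \<in> r" "(Lb k, La i) \<in> r" "(Le, Lb i) \<in> r"
    if "i \<in> {1..n}" "j \<in> {1..n}" "k \<in> {1..n}" "l \<in> {1..n}" for i j k l
    using order that unfolding admissible_letter_order_def by blast+
  have low: "(Lx, Le) \<in> r" "(Ly, Lx) \<in> r"
    using order unfolding admissible_letter_order_def by blast+
  have x: "(Lx, Lb i) \<in> r" "(Lx, La i) \<in> r" if "i \<in> {1..n}" for i
    using ord that low one tr by (meson transD)+
  have a: "(La i, Laj i j) \<in> r" "(Lb i, Lbj i j) \<in> r" if "i \<in> {1..n}" "j \<in> {1..n}" for i j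
    using ord that one tr by (meson transD)+
  show up: "(c, raised c j) \<in> r" if "c \<in> parens n" "j \<in> {1..n}" for c j
    using that(1) by (cases rule: parens_cases) (use a that(2) in auto)
  have xc: "(Lx, c) \<in> r" if "c \<in> parens n" for c
    using that by (cases rule: parens_cases) (use x in auto)
  show "(Lx, raised c j) \<in> r" if "c \<in> parens n" "j \<in> {1..n}" for c j
    using transD[OF tr xc up] that by blast
  show "(Ly, c) \<in> r" if "c \<in> parens n" for c
    using transD[OF tr low(2) xc] that by blast
qed

lemma deg_terminals: "v \<in> lists (terminals m) \<Longrightarrow> deg v = length v"
  by (induction v) (auto simp: terminals_def)

lemma letter_degree_parens [simp]: "c \<in> parens n \<Longrightarrow> letter_degree d c = d"
  by (erule parens_cases) auto

lemma letter_degree_raised [simp]: "c \<in> parens n \<Longrightarrow> letter_degree d (raised c j) = d"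
  by (erule parens_cases) auto

lemma raised_neq:
  assumes "c \<in> parens n"
  shows "raised c j \<noteq> c" "raised c j \<noteq> Lx" "raised c j \<noteq> Ly" "raised c j \<noteq> Le" "raised c j \<notin> parens n"
  using assms by (auto elim: parens_cases)

text \<open>Every rule makes the first letter smaller without raising the degree, so the comparison
  is decided at the first letter, whatever \<open>s\<close> is.\<close>

lemma rule_decreasing:
  assumes "(u, Some v) \<in> basic_rules" "s \<in> lists X"
  shows "(v @ s, u @ s) \<in> wless"
  using assms(1)
proof cases
  case (commute i)
  then show ?thesis using assms(2) letter_order(2)[of "La i" i] by (auto intro!: wless_hd)
next
  case create
  then show ?thesis using assms(2) letter_order(2)[of "Lb 1" 1] n_pos by (auto intro!: wless_hd)
next
  case (move c c' j)
  then show ?thesis using assms(2) letter_order(1)[of c j] raised_neq(1)[of c j]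
    by (auto intro!: wless_hd simp: raised_letters parens_letters)
next
  case (close c j)
  then show ?thesis using assms(2) letter_order(1)[of c j] raised_neq(1)[of c j]
    by (auto intro!: wless_hd simp: raised_letters parens_letters)
next
  case (translate c)
  \<comment> \<open>A parenthesis of degree \<open>d\<close> is traded for at most \<open>d\<close>
    terminals of degree 1. This is where the choice of \<open>d\<close> enters.\<close>
  have "\<phi> [c] \<in> lists (terminals m)" using translate phi_terminals[of "[c]"] by simp
  then have "\<phi> [c] \<in> lists X" "deg (\<phi> [c]) \<le> d"
    using length_le translate deg_terminals by (auto intro: terminals_letters)
  then show ?thesis using translate assms(2) letter_order(3)[of c]
    by (auto intro!: wless_hd simp: parens_letters)
qed

lemma rule_letters:
  assumes "(u, z) \<in> basic_rules"
  shows "u \<in> lists X"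
  using assms by cases (use n_pos in \<open>auto simp: raised_letters parens_letters\<close>)

abbreviation wle :: "letter list \<Rightarrow> letter list \<Rightarrow> bool" where
  "wle u v \<equiv> u = v \<or> (u, v) \<in> wless"

lemma wle_trans: "wle u v \<Longrightarrow> wle v w \<Longrightarrow> wle u w"
  using trans by (metis transD)

lemma wle_Cons: "wle u v \<Longrightarrow> c \<in> X \<Longrightarrow> wle (c # u) (c # v)"
  using wless_Cons by blast

lemma wle_lists: "wle u v \<Longrightarrow> v \<in> lists X \<Longrightarrow> u \<in> lists X"
  by (auto simp: deglex_def)

lemma act_paren_le:
  assumes "c \<in> parens n" "s \<in> lists X"
  shows "wle (act_paren c s) (c # s)"
proof (cases "s \<noteq> [] \<and> hd s = Ly")
  case True
  then obtain t where "s = Ly # t" by (cases s) auto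
  then show ?thesis
    using rule_decreasing[OF basic_rules.translate[OF assms(1)], of t] assms(2)
    by (simp add: act_paren_def)
qed (auto simp: act_paren_def)

text \<open>Each branch that changes the word applies one basic rule at the front and then acts on
  the tail, which the induction hypothesis or \<open>act_paren_le\<close> bounds where
  needed.\<close>

lemma act_raised_le:
  assumes "c \<in> parens n" "j \<in> {1..n}" "s \<in> lists X" "act_raised s c j = Some s'"
  shows "wle s' (raised c j # s)"
  using assms
proof (induction s arbitrary: c s')
  case (Cons s0 s)
  note s = Cons.prems(3)[simplified]
  have c: "c \<in> X" using Cons.prems(1) by (rule parens_letters)
  consider (paren) "s0 \<in> parens n" | (Le) "s0 = Le" | (a) "s0 = Lx" "c = La j"
    | (b) "s0 = Lx" "c = Lb 1" "j = 1" | (id) "s' = raised c j # s0 # s"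
    using Cons.prems(4) by (auto split: if_splits)
  then show ?case
  proof cases
    case paren
    then obtain u where u: "act_raised s s0 j = Some u" "s' = act_paren c u"
      using Cons.prems(4) by auto
    have "wle u (raised s0 j # s)" using Cons.IH[OF paren _ _ u(1)] Cons.prems s by simp
    \<comment> \<open>Membership in \<open>lists X\<close> is inherited downwards, since
      \<open>wless\<close> relates only words over \<open>X\<close>.\<close>
    moreover from this have "u \<in> lists X"
      by (rule wle_lists) (use s paren Cons.prems raised_letters in simp)
    ultimately have "wle s' (c # raised s0 j # s)"
      unfolding u(2) using wle_trans[OF act_paren_le wle_Cons] Cons.prems(1) c by blast
    then show ?thesis
      using rule_decreasing[OF basic_rules.move[OF Cons.prems(1) paren Cons.prems(2)], of s] s wle_trans
      by auto
  next
    case Le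
    have s': "s' = act_paren c (act_paren (Lb j) s)" using Le Cons.prems(4) by simp
    have 1: "wle (act_paren (Lb j) s) (Lb j # s)" using act_paren_le[of "Lb j" s] Cons.prems(2) s by auto
    moreover from this have "act_paren (Lb j) s \<in> lists X"
      by (rule wle_lists) (use s Cons.prems in simp)
    ultimately have "wle s' (c # Lb j # s)"
      unfolding s' using wle_trans[OF act_paren_le wle_Cons] Cons.prems(1) c by blast
    then show ?thesis
      using rule_decreasing[OF basic_rules.close[OF Cons.prems(1,2)], of s] s wle_trans Le by auto
  next
    case a
    then obtain u where u: "act_raised s c j = Some u" "act_x u = Some s'"
      using Cons.prems(4) by (auto simp: bind_eq_Some_conv)
    have "wle u (raised c j # s)" using Cons.IH[OF _ _ _ u(1)] Cons.prems s by simp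
    then have "wle s' (Lx # raised c j # s)"
      using u(2) wle_Cons[of u _ Lx] by (auto simp: act_x_def split: if_splits)
    then show ?thesis
      using rule_decreasing[OF basic_rules.commute[OF Cons.prems(2)], of s] s a wle_trans by auto
  next
    case b
    then have "s' = Lx # Le # s" using Cons.prems(4) by (auto simp: act_x_def split: if_splits)
    then show ?thesis
      using rule_decreasing[OF basic_rules.create, of s] s b by auto
  qed simp
qed simp

lemma act_le:
  assumes "c \<in> X" "s \<in> lists X" "act c s = Some s'"
  shows "wle s' (c # s)"
  using assms(1)
proof (cases rule: letters_cases)
  case 1
  then show ?thesis using assms act_paren_le by (auto simp: act_parens)
next
  case (2 c' j)
  then show ?thesis using assms act_raised_le by (auto simp: act_raised_letter)
next
  case 3
  then show ?thesis using assms by (auto simp: act_x_def split: if_splits)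
qed (use assms act_terminals in auto)

lemma reduce_le:
  assumes "w \<in> lists X" "reduce w (Some []) = Some s"
  shows "wle s w"
  using assms
proof (induction w arbitrary: s)
  case (Cons c w)
  obtain t where t: "reduce w (Some []) = Some t" "act c t = Some s"
    using Cons.prems by (auto simp: bind_eq_Some_conv)
  have "wle t w" using Cons.IH[OF t(1)] .
  moreover from this have "t \<in> lists X" using Cons.hyps(2) by (rule wle_lists)
  ultimately show ?case
    using wle_trans[OF act_le[OF Cons.hyps(1) _ t(2)] wle_Cons[OF _ Cons.hyps(1)]] by blast
qed simp

section \<open>The rules as polynomials\<close>

lemma lm_rule_poly:
  assumes "\<rho> \<in> basic_rules \<union> accept_rules"
  shows "lm wless (rule_poly \<rho> :: letter list \<Rightarrow>\<^sub>0 'k::field) = fst \<rho>"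
proof -
  obtain u z where \<rho>: "\<rho> = (u, z)" by (cases \<rho>)
  show ?thesis
  proof (cases z)
    case None
    then show ?thesis by (simp add: \<rho> rule_poly_def lm_word_poly)
  next
    case (Some v)
    then have "(v, u) \<in> wless"
      using assms rule_decreasing[of u v "[]"] by (auto simp: \<rho> accept_rules_def)
    then show ?thesis using Some by (simp add: \<rho> rule_poly_def lm_binomial)
  qed
qed

lemma rule_poly_nonzero:
  assumes "\<rho> \<in> basic_rules \<union> accept_rules"
  shows "(rule_poly \<rho> :: letter list \<Rightarrow>\<^sub>0 'k::field) \<noteq> 0"
proof -
  obtain u z where \<rho>: "\<rho> = (u, z)" by (cases \<rho>)
  have "z \<noteq> Some u"
    using assms rule_decreasing[of u u "[]"] irrefl
    by (auto simp: \<rho> accept_rules_def irrefl_def)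
  then have "Poly_Mapping.lookup (rule_poly \<rho> :: letter list \<Rightarrow>\<^sub>0 'k) u = 1"
    by (auto simp: \<rho> rule_poly_def word_poly_def lookup_minus lookup_single when_def split: option.split)
  then show ?thesis by auto
qed

lemma rule_poly_basic_rules:
  "rule_poly ` basic_rules = relations_i n \<union> relations_ii n \<union>
    (relations_iii n \<phi> :: (letter list \<Rightarrow>\<^sub>0 'k::field) set)" (is "?L = ?R")
proof
  show "?L \<subseteq> ?R"
  proof
    fix f :: "letter list \<Rightarrow>\<^sub>0 'k" assume "f \<in> ?L"
    then obtain u z where f: "f = rule_poly (u, z)" and "(u, z) \<in> basic_rules" by auto
    from this(2) show "f \<in> ?R"
    proof cases
      case (translate c)
      \<comment> \<open>In \<open>relations_iii\<close> these elements carry an index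
        \<open>j\<close> that does not occur in them; \<open>n_pos\<close> supplies one.\<close>
      then show ?thesis using n_pos unfolding f relations_iii_def
        by (auto simp: rule_poly_def elim!: parens_cases)
    next
      case (kill c j)
      from kill(3) show ?thesis unfolding f relations_iii_def kill(1,2)
        by (elim parens_cases) (use kill(4) in \<open>force simp: rule_poly_def\<close>)+
    next
      case (commute i)
      then show ?thesis unfolding f relations_i_def by (auto simp: rule_poly_def)
    next
      case create
      then show ?thesis unfolding f relations_i_def by (auto simp: rule_poly_def)
    next
      case (move c c' j)
      from move(3,4) show ?thesis unfolding f relations_ii_def move(1,2)
        by (elim parens_cases) (use move(5) in \<open>force simp: rule_poly_def\<close>)+
    next
      case (close c j)
      from close(3) show ?thesis unfolding f relations_ii_def close(1,2)
        by (elim parens_cases) (use close(4) in \<open>force simp: rule_poly_def\<close>)+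
    qed
  qed
  have *: "word_poly u - word_poly v \<in> ?L" if "(u, Some v) \<in> basic_rules" for u v
    using imageI[OF that, of rule_poly] by (simp add: rule_poly_def)
  have **: "word_poly u \<in> ?L" if "(u, None) \<in> basic_rules" for u
    using imageI[OF that, of rule_poly] by (simp add: rule_poly_def)
  have la: "La i \<in> parens n" "Lb i \<in> parens n" if "i \<in> {1..n}" for i
    using that by simp_all
  have "relations_i n \<subseteq> ?L"
    unfolding relations_i_def using *[OF basic_rules.commute] *[OF basic_rules.create] by blast
  moreover have "relations_ii n \<subseteq> ?L"
    unfolding relations_ii_def
    using *[OF basic_rules.move[OF la(1) la(1)]] *[OF basic_rules.move[OF la(1) la(2)]]
      *[OF basic_rules.move[OF la(2) la(1)]] *[OF basic_rules.move[OF la(2) la(2)]]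
      *[OF basic_rules.close[OF la(1)]] *[OF basic_rules.close[OF la(2)]]
    by (intro UN_least) simp
  moreover have "relations_iii n \<phi> \<subseteq> ?L"
    unfolding relations_iii_def
    using *[OF basic_rules.translate[OF la(1)]] *[OF basic_rules.translate[OF la(2)]]
      **[OF basic_rules.kill[OF la(1)]] **[OF basic_rules.kill[OF la(2)]]
    by (intro UN_least) simp
  ultimately show "?R \<subseteq> ?L" by blast
qed

lemma rule_poly_accept_rules:
  "rule_poly ` accept_rules = (monomials_xPyLe n (\<phi> ` dyck n) :: (letter list \<Rightarrow>\<^sub>0 'k::field) set)"
proof -
  have "rule_poly ` accept_rules = (\<lambda>\<rho>. word_poly (fst \<rho>)) ` accept_rules"
    by (intro image_cong) (auto simp: accept_rules_def rule_poly_def)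
  also have "\<dots> = monomials_xPyLe n (\<phi> ` dyck n)"
    unfolding accept_rules_def monomials_xPyLe_def by force
  finally show ?thesis .
qed

section \<open>No left-hand side is a subword of another\<close>

lemma basic_rule_lhs:
  assumes "(u, z) \<in> basic_rules"
  obtains c j s where "u = [raised c j, s]" "c \<in> parens n" | c where "u = [c, Ly]" "c \<in> parens n"
proof -
  have *: "Laj i j = raised (La i) j" "Lbj i j = raised (Lb i) j" for i j by simp_all
  show ?thesis
    using assms
  proof cases
    case create
    then show ?thesis using that(1)[of "Lb 1" 1 Lx] n_pos by simp
  qed (use that in \<open>auto simp only: * parens_simps\<close>)
qed

text \<open>Two rules with a common left-hand side would give different elements with the same
  leading word and violate minimality.\<close>

lemma basic_rules_functional:
  assumes "(u, z) \<in> basic_rules" "(u, z') \<in> basic_rules"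
  shows "z = z'"
proof -
  have raised_inj: "c = c' \<and> j = j'" if "raised c j = raised c' j'" "c \<in> parens n" "c' \<in> parens n" for c c' j j'
    using that by (auto elim!: parens_cases)
  show ?thesis
    using assms by (auto elim!: basic_rules.cases simp: raised_neq dest: raised_inj)
qed

lemma accept_rule_cases:
  assumes "(u, z) \<in> accept_rules"
  obtains p v where "u = Lx # p @ Ly # v @ [Le]" "z = None" "p \<in> lang_P n" "v \<in> \<phi> ` dyck n"
    "set p \<subseteq> insert Le (parens n)" "set v \<subseteq> terminals m"
  using assms dyck_parens phi_terminals lang_P_letters unfolding accept_rules_def by fastforce

text \<open>No raised letter occurs in x p y v e, and its only y is preceded by x or, by
  \<open>lang_P_snoc\<close>, by e, never by a parenthesis.\<close>

lemma basic_not_sublist_accept: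
  assumes "(u, z) \<in> accept_rules" "(u', z') \<in> basic_rules"
  shows "\<not> sublist u' u"
proof
  assume sub: "sublist u' u"
  from assms(1) obtain p v where u: "u = Lx # p @ Ly # v @ [Le]" and p: "p \<in> lang_P n"
    "set p \<subseteq> insert Le (parens n)" and v: "set v \<subseteq> terminals m"
    by (rule accept_rule_cases)
  from assms(2) show False
  proof (cases rule: basic_rule_lhs)
    case (1 c j s)
    then have "raised c j \<in> set u" using set_mono_sublist[OF sub] by simp
    then show False
      using 1(2) p(2) v raised_neq[OF 1(2), of j] raised_neq(5)[OF 1(2), of j]
      by (auto simp: u terminals_def elim!: parens_cases)
  next
    case (2 c)
    obtain A B where AB: "u = A @ [c, Ly] @ B" using sub 2 by (auto simp: sublist_def)
    have "Ly \<notin> set (Lx # p)" "Ly \<notin> set (v @ [Le])"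
      using p(2) v by (auto simp: terminals_def)
    moreover have "(Lx # p) @ Ly # (v @ [Le]) = (A @ [c]) @ Ly # B" using AB u by simp
    ultimately have "Lx # p = A @ [c]" using append_Cons_eq_iff by metis
    moreover have "c \<noteq> Lx" "c \<noteq> Le" using 2(2) by auto
    ultimately show False using lang_P_snoc[OF p(1)] by (auto simp: append_eq_Cons_conv Cons_eq_append_conv)
  qed
qed

text \<open>In x p y v e the letters x and y occur once, and e occurs once behind y. These three
  positions pin down the smaller word inside the larger one and force \<open>p = p'\<close> and
  \<open>v = v'\<close>.\<close>

lemma accept_not_sublist_accept:
  assumes "(u, z) \<in> accept_rules" "(u', z') \<in> accept_rules" "sublist u' u"
  shows "u' = u"
proof -
  from assms(1) obtain p v where u: "u = Lx # p @ Ly # v @ [Le]"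
    and p: "set p \<subseteq> insert Le (parens n)" and v: "set v \<subseteq> terminals m"
    by (rule accept_rule_cases)
  from assms(2) obtain p' v' where u': "u' = Lx # p' @ Ly # v' @ [Le]"
    and p': "set p' \<subseteq> insert Le (parens n)" and v': "set v' \<subseteq> terminals m"
    by (rule accept_rule_cases)
  obtain A B where AB: "u = A @ u' @ B" using assms(3) by (auto simp: sublist_def)
  have "Lx \<notin> set []" "Lx \<notin> set (p @ Ly # v @ [Le])"
    using p v by (auto simp: terminals_def)
  moreover have "[] @ Lx # (p @ Ly # v @ [Le]) = A @ Lx # (p' @ Ly # v' @ [Le] @ B)"
    using AB u u' by simp
  ultimately have 1: "p @ Ly # (v @ [Le]) = p' @ Ly # (v' @ [Le] @ B)"
    using append_Cons_eq_iff by metis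
  have "Ly \<notin> set p" "Ly \<notin> set (v @ [Le])"
    using p v by (auto simp: terminals_def)
  with 1 have 2: "p = p'" "v @ Le # [] = v' @ Le # B"
    using append_Cons_eq_iff[of Ly p "v @ [Le]"] by auto
  have "Le \<notin> set v" "Le \<notin> set []" using v by (auto simp: terminals_def)
  with 2(2) have "v = v'" using append_Cons_eq_iff by metis
  with 2(1) show ?thesis using u u' by simp
qed

lemma rules_not_sublist:
  assumes "\<rho> \<in> basic_rules \<union> accept_rules" "\<rho>' \<in> basic_rules \<union> accept_rules"
    "sublist (fst \<rho>') (fst \<rho>)"
  shows "\<rho>' = \<rho>"
proof -
  obtain u z u' z' where \<rho>: "\<rho> = (u, z)" "\<rho>' = (u', z')" by (cases \<rho>, cases \<rho>')
  note sub = assms(3)[unfolded \<rho> fst_conv]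
  have len: "length w = 2" if "(w, y) \<in> basic_rules" for w y
    using that by (cases rule: basic_rule_lhs) auto
  have len': "length w > 2" if "(w, y) \<in> accept_rules" for w y
    using that by (auto simp: accept_rules_def)
  consider "(u, z) \<in> basic_rules" "(u', z') \<in> basic_rules"
    | "(u, z) \<in> basic_rules" "(u', z') \<in> accept_rules"
    | "(u, z) \<in> accept_rules" "(u', z') \<in> basic_rules"
    | "(u, z) \<in> accept_rules" "(u', z') \<in> accept_rules"
    using assms \<rho> by blast
  then show ?thesis
  proof cases
    case 1
    have "u' = u"
      using sub len[OF 1(1)] len[OF 1(2)] by (auto simp: sublist_def)
    then show ?thesis using 1 basic_rules_functional \<rho> by blast
  next
    case 2
    then show ?thesis using len len' sublist_length_le[OF sub] by fastforce
  next
    case 3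
    then show ?thesis using basic_not_sublist_accept sub by blast
  next
    case 4
    then have "u' = u" using accept_not_sublist_accept sub by blast
    moreover have "z = None" "z' = None" using 4 by (auto simp: accept_rules_def)
    ultimately show ?thesis using \<rho> by simp
  qed
qed

section \<open>Accepted words lie in the ideal\<close>

context
  fixes I :: "(letter list \<Rightarrow>\<^sub>0 'k::field) set"
  assumes ideal: "ideal I (free_algebra X)"
    and basic: "rule_poly ` basic_rules \<subseteq> I"
    and xye: "word_poly [Lx, Ly, Le] \<in> I"
begin

abbreviation null :: "letter list \<Rightarrow> bool" where
  "null w \<equiv> word_poly w \<in> I"

lemma null_append:
  assumes "null w" "p \<in> lists X" "q \<in> lists X"
  shows "null (p @ w @ q)"
  using ideal_free_algebra_sandwich[OF ideal assms] by (simp add: word_poly_mult)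

text \<open>Words one rewriting step apart are congruent modulo \<open>I\<close>.\<close>

lemma null_basic_rule:
  assumes "(u, Some v) \<in> basic_rules" "p \<in> lists X" "q \<in> lists X"
  shows "null (p @ u @ q) \<longleftrightarrow> null (p @ v @ q)"
proof -
  have "rule_poly (u, Some v) \<in> I" using basic assms(1) by blast
  from ideal_free_algebra_sandwich[OF ideal this assms(2,3)]
  have diff: "word_poly (p @ u @ q) - word_poly (p @ v @ q) \<in> I"
    by (simp add: rule_poly_def right_diff_distrib left_diff_distrib word_poly_mult)
  from ideal_free_algebra_add[OF ideal diff, of "word_poly (p @ v @ q)"]
    ideal_free_algebra_diff[OF ideal _ diff, of "word_poly (p @ u @ q)"]
  show ?thesis by auto
qed

text \<open>Counterpart of \<open>reduce_raised_word\<close> modulo \<open>I\<close>, again by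
  moving the index through \<open>w\<close> and closing at e.\<close>

lemma null_raised_word:
  assumes "w \<in> lists (parens n)" "c \<in> parens n" "j \<in> {1..n}" "p \<in> lists X" "q \<in> lists X"
  shows "null (p @ raised c j # w @ Le # q) \<longleftrightarrow> null (p @ c # w @ Lb j # q)"
  using assms
proof (induction w arbitrary: c p)
  case Nil
  then show ?case using null_basic_rule[OF basic_rules.close, of c j p q] by simp
next
  case (Cons c' w)
  have w: "w @ Le # q \<in> lists X" using Cons.hyps(2) Cons.prems parens_letters by auto
  have "null (p @ raised c j # (c' # w) @ Le # q) \<longleftrightarrow>
      null (p @ [raised c j, c'] @ (w @ Le # q))" by simp
  also have "\<dots> \<longleftrightarrow> null ((p @ [c]) @ raised c' j # w @ Le # q)"
    using null_basic_rule[OF basic_rules.move, of c c' j p "w @ Le # q"] Cons.hyps(1) Cons.prems w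
    by simp
  also have "\<dots> \<longleftrightarrow> null ((p @ [c]) @ c' # w @ Lb j # q)"
    using Cons.hyps Cons.prems parens_letters by (intro Cons.IH) auto
  finally show ?case by simp
qed

lemma null_translate:
  assumes "w \<in> lists (parens n)" "p \<in> lists X" "q \<in> lists X"
  shows "null (p @ w @ Ly # q) \<longleftrightarrow> null (p @ Ly # \<phi> w @ q)"
  using assms
proof (induction w arbitrary: p)
  case (Cons c w)
  have q: "\<phi> w @ q \<in> lists X"
    using phi_terminals[OF Cons.hyps(2)] Cons.prems terminals_letters by auto
  have "null (p @ (c # w) @ Ly # q) \<longleftrightarrow> null ((p @ [c]) @ w @ Ly # q)" by simp
  also have "\<dots> \<longleftrightarrow> null ((p @ [c]) @ Ly # \<phi> w @ q)"
    using Cons.hyps(1) Cons.prems parens_letters by (intro Cons.IH) auto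
  also have "\<dots> \<longleftrightarrow> null (p @ [c, Ly] @ (\<phi> w @ q))" by simp
  also have "\<dots> \<longleftrightarrow> null (p @ (Ly # \<phi> [c]) @ (\<phi> w @ q))"
    using null_basic_rule[OF basic_rules.translate[OF Cons.hyps(1)] Cons.prems(1) q] .
  finally show ?case using phi_Cons[OF Cons.hyps] by simp
qed simp

lemma null_Le:
  assumes "null (Lx # q)" "q \<in> lists X"
  shows "null (Lx # Le # q)"
  using null_append[OF assms(1), of "[Lbj 1 1]" "[]"] null_basic_rule[OF basic_rules.create, of "[]" q]
    assms(2) n_pos by simp

lemma null_dyck:
  assumes "w \<in> dyck n" "null (Lx # q)" "q \<in> lists X"
  shows "null (Lx # w @ q)"
  using assms
proof (induction arbitrary: q)
  case (append u v)
  have "v @ q \<in> lists X"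
    using dyck_parens[OF append.hyps(2)] append.prems(2) parens_letters by auto
  then show ?case using append by simp
next
  case (nest w i)
  have w: "w \<in> lists (parens n)" by (rule dyck_parens[OF nest.hyps(1)])
  have wq: "w @ Le # q \<in> lists X" using w nest.prems(2) parens_letters by auto
  \<comment> \<open>The induction hypothesis is used with \<open>Le # q\<close>: the extra e is the
    letter that will become \<open>Lb i\<close>.\<close>
  have "null (Lx # w @ Le # q)"
    using nest.prems null_Le by (intro nest.IH) auto
  then have "null ([] @ [Laj i i, Lx] @ (w @ Le # q))"
    using null_append[of "Lx # w @ Le # q" "[Laj i i]" "[]"] nest.hyps(2) by simp
  then have "null ([Lx] @ raised (La i) i # w @ Le # q)"
    using null_basic_rule[OF basic_rules.commute[OF nest.hyps(2)] _ wq, of "[]"] by simp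
  then show ?case
    using null_raised_word[OF w, of "La i" i "[Lx]" q] nest.hyps(2) nest.prems(2) by simp
qed simp

text \<open>Starting from xye, a Dyck word inserted between x and y is translated into
  \<open>v\<close>; then the blocks of \<open>p\<close> are inserted behind x from the last to the
  first.\<close>

lemma null_accept:
  assumes "p \<in> lang_P n" "v \<in> \<phi> ` dyck n"
  shows "null ([Lx] @ p @ [Ly] @ v @ [Le])"
  using assms(1)
proof (induction rule: lang_P_induct)
  case Nil
  obtain w where w: "w \<in> dyck n" "v = \<phi> w" using assms(2) by blast
  have "null (Lx # w @ [Ly, Le])" using null_dyck[OF w(1)] xye by simp
  then show ?case
    using null_translate[OF dyck_parens[OF w(1)], of "[Lx]" "[Le]"] w(2) by simp
next
  case (Cons w p)
  obtain u where u: "u \<in> dyck n" "v = \<phi> u" using assms(2) by blast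
  have "p @ [Ly] @ v @ [Le] \<in> lists X"
    using lang_P_letters[OF Cons.hyps(2)] phi_terminals[OF dyck_parens[OF u(1)]] u(2)
      parens_letters terminals_letters by auto
  then show ?case using null_dyck[OF Cons.hyps(1) null_Le] Cons.IH by simp
qed

lemma rule_poly_in_ideal: "rule_poly ` (basic_rules \<union> accept_rules) \<subseteq> I"
  using basic null_accept by (auto simp: accept_rules_def rule_poly_def)

end

section \<open>The minimal Groebner basis\<close>

lemma minimal_groebner_basis:
  fixes I :: "(letter list \<Rightarrow>\<^sub>0 'k::field) set"
  defines "I \<equiv> Idl\<^bsub>free_algebra X\<^esub> (rule_poly ` basic_rules \<union> relations_iv)"
  shows "is_minimal_groebner_basis X wless I (rule_poly ` (basic_rules \<union> accept_rules))"
    and "rule_poly ` basic_rules \<inter> rule_poly ` accept_rules = ({} :: (letter list \<Rightarrow>\<^sub>0 'k) set)"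
proof -
  let ?S = "rule_poly ` basic_rules \<union> relations_iv :: (letter list \<Rightarrow>\<^sub>0 'k) set"
  let ?U = "rule_poly ` (basic_rules \<union> accept_rules) :: (letter list \<Rightarrow>\<^sub>0 'k) set"
  interpret ring "free_algebra X :: (letter list \<Rightarrow>\<^sub>0 'k) ring" by (rule ring_free_algebra)
  have carr: "rule_poly \<rho> \<in> carrier (free_algebra X)" if "\<rho> \<in> basic_rules" for \<rho>
  proof -
    obtain u z where \<rho>: "\<rho> = (u, z)" by (cases \<rho>)
    have u: "u \<in> lists X" using rule_letters that \<rho> by blast
    have v: "v \<in> lists X" if "z = Some v" for v
      using wle_lists[of v u] rule_decreasing[of u v "[]"] that \<open>\<rho> \<in> basic_rules\<close> \<rho> u by auto
    show ?thesis
    proof (cases z)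
      case (Some v)
      then show ?thesis
        using u v keys_diff[of "word_poly u" "word_poly v"]
        by (auto simp: \<rho> rule_poly_def carrier_free_algebra_iff word_poly_def split: if_splits)
    qed (use u in \<open>simp add: \<rho> rule_poly_def\<close>)
  qed
  have S: "?S \<subseteq> carrier (free_algebra X)" using carr by (auto simp: relations_iv_def)
  have I: "ideal I (free_algebra X)" unfolding I_def by (rule genideal_ideal[OF S])
  have U: "?U \<subseteq> I"
    using genideal_self[OF S] by (intro rule_poly_in_ideal[OF I]) (auto simp: I_def relations_iv_def)
  \<comment> \<open>The functional reads off the coefficient of \<open>c\<close> in the normal form.
    Words act from their right end, so \<open>q\<close> comes first: it yields zero or a word
    \<open>s\<close>, on which both sides of a relation act alike before \<open>p\<close> is
    applied.\<close>
  have inv: "lin_ext (\<lambda>w. of_bool (reduce (p @ w @ q) (Some []) = Some c)) f = 0"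
    if "f \<in> ?S" for f :: "letter list \<Rightarrow>\<^sub>0 'k" and p q c
  proof (cases "reduce q (Some [])")
    case None
    then have "lin_ext (\<lambda>w. of_bool (reduce (p @ w @ q) (Some []) = Some c)) f = lin_ext (\<lambda>w. 0) f"
      by simp
    then show ?thesis by (simp add: lin_ext_def)
  next
    case (Some s)
    from that consider u z where "(u, z) \<in> basic_rules" "f = rule_poly (u, z)"
      | "f = word_poly [Lx, Ly, Le]"
      by (auto simp: relations_iv_def)
    then show ?thesis
    proof cases
      case (1 u z)
      then show ?thesis using reduce_basic_rule[OF 1(1), of s] Some
        by (cases z) (simp_all add: rule_poly_def lin_ext_diff del: reduce_simps(1,2))
    next
      case 2
      then show ?thesis using reduce_xye[of s] Some
        by (simp del: reduce_simps(1,2))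
    qed
  qed
  have "is_groebner_basis X wless I ?U"
  proof (rule groebner_basis_sublistI[OF word_order_axioms I U])
    fix f assume f: "f \<in> I" "f \<noteq> 0"
    have fX: "lm wless f \<in> lists X"
      using lm_greatest(1)[OF ideal.Icarr[OF I f(1)] f(2)] ideal.Icarr[OF I f(1)]
      by (auto simp: carrier_free_algebra_iff)
    \<comment> \<open>The leading word is not its own normal form, so it cannot avoid all left-hand
      sides.\<close>
    have "reduce (lm wless f) (Some []) \<noteq> Some (lm wless f)"
      using lm_not_fixed[where NF = "\<lambda>w. reduce w (Some [])", OF S inv _ f[unfolded I_def]] reduce_le
      by blast
    then obtain \<rho> where \<rho>: "\<rho> \<in> basic_rules \<union> accept_rules" "sublist (fst \<rho>) (lm wless f)"
      using reduce_irreducible[OF fX] by blast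
    show "\<exists>g\<in>?U. g \<noteq> 0 \<and> sublist (lm wless g) (lm wless f)"
    proof (intro bexI conjI)
      show "sublist (lm wless (rule_poly \<rho> :: letter list \<Rightarrow>\<^sub>0 'k)) (lm wless f)"
        using \<rho>(2) by (simp only: lm_rule_poly[OF \<rho>(1)])
    qed (use \<rho>(1) rule_poly_nonzero in blast)+
  qed
  moreover have "\<not> sublist (lm wless g) (lm wless f)" if "f \<in> ?U" "g \<in> ?U" "f \<noteq> g" for f g
  proof
    assume sub: "sublist (lm wless g) (lm wless f)"
    obtain \<rho> \<rho>' where *: "\<rho> \<in> basic_rules \<union> accept_rules" "f = rule_poly \<rho>"
      "\<rho>' \<in> basic_rules \<union> accept_rules" "g = rule_poly \<rho>'"
      using \<open>f \<in> ?U\<close> \<open>g \<in> ?U\<close> by blast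
    have "\<rho>' = \<rho>"
      using sub rules_not_sublist[OF *(1,3)] unfolding *(2,4) lm_rule_poly[OF *(1)] lm_rule_poly[OF *(3)] by simp
    then show False using \<open>f \<noteq> g\<close> *(2,4) by simp
  qed
  moreover have "0 \<notin> ?U"
  proof
    assume "0 \<in> ?U"
    then obtain \<rho> where "\<rho> \<in> basic_rules \<union> accept_rules" "0 = (rule_poly \<rho> :: letter list \<Rightarrow>\<^sub>0 'k)"
      by blast
    then show False using rule_poly_nonzero[of \<rho>, where 'k = 'k] by simp
  qed
  ultimately show "is_minimal_groebner_basis X wless I ?U"
    unfolding is_minimal_groebner_basis_def by blast
  show "rule_poly ` basic_rules \<inter> rule_poly ` accept_rules = ({} :: (letter list \<Rightarrow>\<^sub>0 'k) set)"
  proof (rule equals0I)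
    fix f :: "letter list \<Rightarrow>\<^sub>0 'k"
    assume "f \<in> rule_poly ` basic_rules \<inter> rule_poly ` accept_rules"
    then obtain \<rho> \<rho>' where *: "\<rho> \<in> basic_rules" "\<rho>' \<in> accept_rules" "f = rule_poly \<rho>" "f = rule_poly \<rho>'"
      by blast
    \<comment> \<open>A common element would have one leading word, equal to left-hand sides of both
      kinds.\<close>
    have "fst \<rho>' = lm wless f" unfolding *(4) using *(2) by (simp add: lm_rule_poly)
    moreover have "fst \<rho> = lm wless f" unfolding *(3) using *(1) by (simp add: lm_rule_poly)
    ultimately have "fst \<rho> = fst \<rho>'" by simp
    then show False
      using basic_not_sublist_accept[of "fst \<rho>'" "snd \<rho>'" "fst \<rho>" "snd \<rho>"] *(1,2)
      by (cases \<rho>; cases \<rho>') simp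
  qed
qed

end

theorem theorem1:
  fixes n m d :: nat
    and \<phi> :: "letter list \<Rightarrow> letter list"
    and L :: "letter list set"
    and r :: "letter rel"
    and R G M :: "(letter list \<Rightarrow>\<^sub>0 'k::field) set"
  assumes "n \<ge> 1" and "m \<ge> 1"
    and "word_hom (parens n) (terminals m) \<phi>"
    and "L = \<phi> ` dyck n"
    and "d = Max {length (\<phi> [c]) |c. c \<in> parens n}"
    and "d \<ge> 1"
    and "admissible_letter_order n m r"
    and "R = relations_i n \<union> relations_ii n \<union> relations_iii n \<phi> \<union> relations_iv"
    and "G = relations_i n \<union> relations_ii n \<union> relations_iii n \<phi>"
    and "M = monomials_xPyLe n L"
  shows "is_minimal_groebner_basis (letters n m) (deglex (letters n m) (letter_degree d) r)
           (Idl\<^bsub>free_algebra (letters n m)\<^esub> R) (G \<union> M)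
         \<and> G \<inter> M = {}"
proof -
  have "finite {length (\<phi> [c]) |c. c \<in> parens n}"
    by (simp add: parens_def)
  then have "length (\<phi> [c]) \<le> d" if "c \<in> parens n" for c
    using that unfolding assms(5) by (intro Max_ge) auto
  then interpret dyck_presentation n m d \<phi> r
    using assms by unfold_locales auto
  have G: "G = rule_poly ` basic_rules" and M: "M = rule_poly ` accept_rules"
    unfolding assms(4,9,10) by (rule rule_poly_basic_rules[symmetric] rule_poly_accept_rules[symmetric])+
  have R: "R = rule_poly ` basic_rules \<union> relations_iv"
    using assms(8,9) G by simp
  show ?thesis
    using minimal_groebner_basis[where 'k = 'k] unfolding G M R image_Un by blast
qed

end
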